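(* Let $\alpha\in\mathbb{C}$. The following conditions are equivalent: (i) $(p_{n+1}(\alpha))_{n\ge0}$ is a Stieltjes moment sequence, i.e. there exists a positive measure $\sigma_\alpha$ on $[0,\infty[$ such that $p_{n+1}(\alpha)=\int_0^\infty x^n\,d\sigma_\alpha(x)$ for all $n\ge0$. (ii) $\varphi_\alpha$ is completely monotonic. (iii) $0\le\alpha\le1$ (in particular $\alpha$ is real). If the equivalent conditions hold, then $\sigma_\alpha$ is supported by $[0,1]$, and $(p_{n+1}(\alpha))_{n\ge0}$ is a Hausdorff moment sequence.
   Context: The polynomials $p_n$ are defined by $p_0(\alpha)=1$ and $p_{n+1}(\alpha)=\frac{\alpha}{n+1}\sum_{k=0}^n\frac{k+1}{k+2}p_{n-k}(\alpha)$, $n\ge0$. For $\alpha\in\mathbb{C}$ let $f_\alpha(z)=e^\alpha-\exp(\alpha z\,\mathrm{Log}(1+1/z))$ for $z\in\mathbb{C}\setminus[-1,0]$, with $\mathrm{Log}$ the principal logarithm; $f_\alpha(z)\to e^\alpha-1$ as $z\to0$ within $\mathbb{C}\setminus]-\infty,0]$. The entire function $\varphi_\alpha$ is defined by $$\varphi_\alpha(s)=\frac{1}{2\pi i}\int_{C(r,c)}f_\alpha(z)e^{sz}\,dz,\quad s\in\mathbb{C},$$ where $c>1$, $r>0$ and $C(r,c)$ is the positively oriented boundary of the rectangle with corners $-c\pm ir$, $\pm ir$ (with $f_\alpha(0):=e^\alpha-1$ on the side $[-ir,ir]$); the value does not depend on $c>1$, $r>0$. A function is completely monotonic if it is (on $]0,\infty[$)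 real-valued, infinitely differentiable and $(-1)^nf^{(n)}(x)\ge0$ for all $x>0$, $n=0,1,\ldots$. A Hausdorff moment sequence is the moment sequence of a positive measure on $[0,1]$. *)

theory Defs
  imports "HOL-Complex_Analysis.Complex_Analysis"
begin

fun p_poly :: "nat \<Rightarrow> complex \<Rightarrow> complex" where
  "p_poly 0 \<alpha> = 1"
| "p_poly (Suc n) \<alpha> =
     \<alpha> / of_nat (n + 1) * (\<Sum>k\<le>n. of_nat (k + 1) / of_nat (k + 2) * p_poly (n - k) \<alpha>)"

(* Only the values off the cut [-1,0] and at the point 0 are meaningful; at 0 the function is
   given its limit along the plane cut along the nonpositive real axis. *)
definition f_alpha :: "complex \<Rightarrow> complex \<Rightarrow> complex" where
  "f_alpha \<alpha> z = (if z = 0 then exp \<alpha> - 1 else exp \<alpha> - exp (\<alpha> * z * Ln (1 + 1 / z)))"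

(* rectpath a b takes the lower left and upper right corners and runs counterclockwise. *)
definition rect_contour :: "real \<Rightarrow> real \<Rightarrow> real \<Rightarrow> complex" where
  "rect_contour r c = rectpath (Complex (- c) (- r)) (Complex 0 r)"

(* Meaningful for r > 0 and c > 1, where the value is independent of r and c. *)
definition phi :: "real \<Rightarrow> real \<Rightarrow> complex \<Rightarrow> complex \<Rightarrow> complex" where
  "phi r c \<alpha> s =
     1 / (2 * of_real pi * \<i>) *
     contour_integral (rect_contour r c) (\<lambda>z. f_alpha \<alpha> z * exp (s * z))"

(* Derivatives are taken of the real function Re o f, which is f itself on the positive half
   line once f is real-valued there; the values of f at x \<le> 0 are irrelevant. *)
definition completely_monotonic :: "(real \<Rightarrow> complex) \<Rightarrow> bool" where
  "completely_monotonic f \<longleftrightarrow>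
     (\<forall>x>0. f x \<in> \<real>) \<and>
     (\<forall>n. \<forall>x>0. (deriv ^^ n) (\<lambda>t. Re (f t)) field_differentiable (at x)) \<and>
     (\<forall>n. \<forall>x>0. 0 \<le> (-1) ^ n * (deriv ^^ n) (\<lambda>t. Re (f t)) x)"

(* A Borel measure on S with moment sequence a. Integrability is required explicitly because
   the Bochner integral of a non-integrable function is 0 by convention. *)
definition represents_moments :: "real set \<Rightarrow> real measure \<Rightarrow> (nat \<Rightarrow> complex) \<Rightarrow> bool" where
  "represents_moments S \<sigma> a \<longleftrightarrow>
     sets \<sigma> = sets (restrict_space borel S) \<and>
     (\<forall>n. integrable \<sigma> (\<lambda>x. x ^ n) \<and> a n = complex_of_real (\<integral>x. x ^ n \<partial>\<sigma>))"

definition stieltjes_moment_seq :: "(nat \<Rightarrow> complex) \<Rightarrow> bool" where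
  "stieltjes_moment_seq a \<longleftrightarrow> (\<exists>\<sigma>. represents_moments {0..} \<sigma> a)"

definition hausdorff_moment_seq :: "(nat \<Rightarrow> complex) \<Rightarrow> bool" where
  "hausdorff_moment_seq a \<longleftrightarrow> (\<exists>\<sigma>. represents_moments {0..1} \<sigma> a)"

end

theory Submission
  imports Defs "HOL-Probability.Helly_Selection"
begin

text \<open>
  Put \<open>G(w) = (\<Sum>n. p\<^sub>n w\<^sup>n)\<close>. The recurrence is the differential equation for
  \<open>G(w) = exp (\<alpha> (w/2 + w\<^sup>2/3 + \<dots>)) = exp (\<alpha> (- Ln (1 - w) / w - 1))\<close>, so that
  \<open>f(z) = exp \<alpha> (1 - G(-1/z))\<close> for \<open>\<bar>z\<bar> > 1\<close>. Deforming the rectangle into a circle of radius 2 and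
  integrating this Laurent series term by term gives
  \<open>\<phi>(s) = exp \<alpha> (\<Sum>n. (-1)\<^sup>n p\<^sub>n\<^sub>+\<^sub>1 s\<^sup>n / n!)\<close> (lemma \<open>phi_eq_egf\<close>). From here on both (i) and (ii) are
  statements about the sequence \<open>p\<^sub>n\<^sub>+\<^sub>1\<close> alone.

  Necessity of \<open>0 \<le> \<alpha> \<le> 1\<close>. Each of (i) and (ii) makes the sequence \<open>a\<^sub>n = C p\<^sub>n\<^sub>+\<^sub>1\<close>, with \<open>C = 1\<close> or
  \<open>C = exp \<alpha>\<close>, nonnegative with \<open>a\<^sub>n\<^sub>+\<^sub>2 - 2 l a\<^sub>n\<^sub>+\<^sub>1 + l\<^sup>2 a\<^sub>n \<ge> 0\<close> for all real \<open>l\<close>, hence logarithmically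
  convex. For moments this quadratic form is \<open>\<integral> x\<^sup>n (x - l)\<^sup>2\<close>. For a completely monotonic entire
  function it comes from its Taylor expansion at a point \<open>T > 0\<close>, which exhibits the coefficients
  at \<open>0\<close>, up to terms of order \<open>1/T\<close>, as moments of a discrete measure on the multiples of \<open>1/T\<close>
  (lemma \<open>egf_nonneg_imp_log_convex\<close>), as in the proof of Bernstein's theorem. The ratio
  \<open>a\<^sub>1 / a\<^sub>0 = \<alpha>/4 + 2/3\<close> (for \<open>\<alpha> \<noteq> 0\<close>) forces \<open>\<alpha>\<close> to be real, and \<open>a\<^sub>0 = C \<alpha>/2\<close> forces \<open>\<alpha> \<ge> 0\<close>. As \<open>G\<close> converges in the
  unit disc, the increasing ratios \<open>a\<^sub>n\<^sub>+\<^sub>1 / a\<^sub>n\<close> cannot exceed 1, so the \<open>p\<^sub>n\<close> are bounded and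
  \<open>G(w) = O(1 / (1 - w))\<close> as \<open>w\<close> tends to 1. But \<open>G(w)\<close> grows like \<open>(1 - w)\<^sup>-\<^sup>\<alpha>\<close>, whence \<open>\<alpha> \<le> 1\<close>.

  Sufficiency. Since \<open>log G(w) = \<integral>\<^sub>0\<^sup>1 \<alpha> t w / (1 - w t) dt\<close> has a density \<open>\<alpha> t\<close> with values in \<open>[0,1]\<close>,
  \<open>G\<close> is a limit of finite products of factors \<open>(1 - a\<^sub>j w) / (1 - b\<^sub>j w)\<close> in which the intervals
  \<open>[a\<^sub>j, b\<^sub>j]\<close> follow each other in \<open>[0,1]\<close>: one approximates the density by one that only takes the
  values 0 and 1. Interlacing makes all partial fraction coefficients nonnegative (lemma
  \<open>interlacing_product\<close>), so the coefficients after the constant one are moments of a finite discrete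
  measure on \<open>[0,1]\<close>. Helly's selection theorem turns the limit into a Hausdorff moment sequence
  (lemma \<open>hausdorff_moment_seq_limit\<close>), and complete monotonicity of \<open>\<phi>\<close> follows because then
  \<open>\<phi>(s) = exp \<alpha> \<integral> exp (- s t) d\<sigma>(t)\<close>. Finally, bounded moments force every representing measure on
  the half line to live on \<open>[0,1]\<close>.
\<close>

section \<open>The generating function of the polynomials\<close>

lemma p_poly_recurrence:
  "of_nat (Suc n) * p_poly (Suc n) \<alpha> =
     \<alpha> * (\<Sum>k\<le>n. of_nat (k + 1) / of_nat (k + 2) * p_poly (n - k) \<alpha>)"
proof -
  have "of_nat (Suc n) \<noteq> (0::complex)" by (rule of_nat_neq_0)
  then show ?thesis by (simp add: field_simps del: of_nat_Suc)
qed

text \<open>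
  The coefficients of \<open>(1 - w)\<^sup>-\<^sup>A\<close> satisfy the recurrence of the \<open>p\<^sub>n\<close> with all weights
  \<open>(k + 1) / (k + 2)\<close> replaced by 1. Hence they dominate the \<open>p\<^sub>n\<close> when \<open>A = \<bar>\<alpha>\<bar>\<close>.
\<close>

lemma sum_pochhammer_over_fact:
  fixes A :: real
  shows "A * (\<Sum>j\<le>n. pochhammer A j / fact j) = real (Suc n) * (pochhammer A (Suc n) / fact (Suc n))"
proof (induction n)
  case (Suc n)
  have "A * (\<Sum>j\<le>Suc n. pochhammer A j / fact j) =
      real (Suc n) * (pochhammer A (Suc n) / fact (Suc n)) + A * (pochhammer A (Suc n) / fact (Suc n))"
    using Suc by (simp add: distrib_left)
  also have "\<dots> = (A + real (Suc n)) * (pochhammer A (Suc n) / fact (Suc n))"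
    by (metis add.commute distrib_right)
  also have "\<dots> = real (Suc (Suc n)) * (pochhammer A (Suc (Suc n)) / fact (Suc (Suc n)))"
    by (subst pochhammer_Suc[of _ "Suc n"], subst fact_Suc[of "Suc n"])
       (simp add: divide_simps del: fact_Suc of_nat_Suc)
  finally show ?case .
qed simp

lemma norm_p_poly_le: "norm (p_poly n \<alpha>) \<le> pochhammer (norm \<alpha>) n / fact n"
proof (induction n rule: less_induct)
  case (less n)
  show ?case
  proof (cases n)
    case (Suc m)
    have "real (Suc m) * norm (p_poly (Suc m) \<alpha>) =
        norm \<alpha> * norm (\<Sum>k\<le>m. of_nat (k + 1) / of_nat (k + 2) * p_poly (m - k) \<alpha>)"
      using arg_cong[OF p_poly_recurrence[of m \<alpha>], of norm]
      by (simp only: norm_mult norm_of_nat)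
    also have "\<dots> \<le> norm \<alpha> * (\<Sum>k\<le>m. pochhammer (norm \<alpha>) (m - k) / fact (m - k))"
    proof (intro mult_left_mono sum_norm_le norm_ge_zero)
      fix k assume "k \<in> {..m}"
      then have "norm (p_poly (m - k) \<alpha>) \<le> pochhammer (norm \<alpha>) (m - k) / fact (m - k)"
        using less Suc by simp
      moreover have "norm (of_nat (k + 1) / of_nat (k + 2) :: complex) \<le> 1"
        unfolding norm_divide norm_of_nat by simp
      ultimately have "norm (of_nat (k + 1) / of_nat (k + 2) :: complex) * norm (p_poly (m - k) \<alpha>)
          \<le> 1 * (pochhammer (norm \<alpha>) (m - k) / fact (m - k))"
        by (intro mult_mono) auto
      then show "norm (of_nat (k + 1) / of_nat (k + 2) * p_poly (m - k) \<alpha>)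
          \<le> pochhammer (norm \<alpha>) (m - k) / fact (m - k)"
        by (simp only: norm_mult mult_1)
    qed
    also have "(\<Sum>k\<le>m. pochhammer (norm \<alpha>) (m - k) / fact (m - k)) =
        (\<Sum>k\<le>m. pochhammer (norm \<alpha>) k / fact k)"
      by (rule sum.nat_diff_reindex[of "\<lambda>k. pochhammer (norm \<alpha>) k / fact k" "Suc m",
            unfolded lessThan_Suc_atMost, simplified])
    finally have "real (Suc m) * norm (p_poly (Suc m) \<alpha>) \<le>
        real (Suc m) * (pochhammer (norm \<alpha>) (Suc m) / fact (Suc m))"
      unfolding sum_pochhammer_over_fact .
    then show ?thesis
      unfolding Suc by (subst (asm) mult_le_cancel_left_pos) simp_all
  qed simp
qed

lemma summable_norm_p_poly:
  assumes "norm w < 1"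
  shows "summable (\<lambda>n. norm (p_poly n \<alpha> * w ^ n))"
proof (rule summable_comparison_test')
  have "summable (\<lambda>n. (- norm \<alpha> gchoose n) * (- norm w) ^ n)"
    using gen_binomial_real[of "- norm w" "- norm \<alpha>"] assms by (auto simp: sums_iff)
  moreover have "(- norm \<alpha> gchoose n) * (- norm w) ^ n = pochhammer (norm \<alpha>) n / fact n * norm w ^ n" for n
    by (simp add: gbinomial_pochhammer power_minus[of "norm w"] flip: power_add mult_2)
  ultimately show "summable (\<lambda>n. pochhammer (norm \<alpha>) n / fact n * norm w ^ n)"
    by simp
  show "norm (norm (p_poly n \<alpha> * w ^ n)) \<le> pochhammer (norm \<alpha>) n / fact n * norm w ^ n" for n
    using mult_right_mono[OF norm_p_poly_le, of "norm w ^ n" n \<alpha>] by (simp add: norm_mult norm_power)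
qed

lemma p_poly_le_exponential: "\<exists>M. \<forall>n. norm (p_poly n \<alpha>) \<le> M * 2 ^ n"
proof -
  have "summable (\<lambda>n. norm (p_poly n \<alpha> * (1 / 2) ^ n))"
    by (rule summable_norm_p_poly) simp
  then have "Bseq (\<lambda>n. norm (p_poly n \<alpha> * (1 / 2) ^ n))"
    by (intro convergent_imp_Bseq) (auto dest: summable_LIMSEQ_zero simp: convergent_def)
  then obtain M where "\<And>n. norm (p_poly n \<alpha>) * (1 / 2) ^ n \<le> M"
    unfolding Bseq_def by (auto simp: norm_mult norm_power norm_divide)
  then have "norm (p_poly n \<alpha>) \<le> M * 2 ^ n" for n
    by (simp add: field_simps)
  then show ?thesis by blast
qed

text \<open>
  The power series of \<open>- Ln (1 - w) / w\<close>, which is also correct at \<open>w = 0\<close>.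
\<close>

definition log_series :: "complex \<Rightarrow> complex" where
  "log_series w = (\<Sum>k. 1 / of_nat (Suc k) * w ^ k)"

lemma log_series_eq_Ln:
  assumes "norm w < 1" "w \<noteq> 0"
  shows "log_series w = - Ln (1 - w) / w"
proof -
  have "(\<lambda>n. (- 1) ^ Suc n / of_nat n * (- w) ^ n) sums Ln (1 - w)"
    using Ln_series[of "- w"] assms by simp
  also have "(\<lambda>n. (- 1) ^ Suc n / of_nat n * (- w) ^ n) = (\<lambda>n. - (w ^ n / of_nat n))"
    by (simp add: power_minus[of w] fun_eq_iff flip: power_add mult_2)
  finally have "(\<lambda>n. - (w ^ Suc n / of_nat (Suc n))) sums Ln (1 - w)"
    using sums_Suc_iff[of "\<lambda>n. - (w ^ n / of_nat n)" "Ln (1 - w)"] by simp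
  from sums_divide[OF this, of "- w"]
  have "(\<lambda>n. 1 / of_nat (Suc n) * w ^ n) sums (Ln (1 - w) / - w)"
    using assms by (simp add: field_simps del: of_nat_Suc)
  then show ?thesis unfolding log_series_def by (simp add: sums_iff)
qed

lemma summable_log_series_deriv:
  fixes w :: complex
  assumes "norm w < 1"
  shows "summable (\<lambda>k. norm (of_nat (k + 1) / of_nat (k + 2) * w ^ k))"
proof (rule summable_comparison_test')
  show "summable (\<lambda>k. norm w ^ k)" using assms by (simp add: summable_geometric)
  show "norm (norm (of_nat (k + 1) / of_nat (k + 2) * w ^ k)) \<le> norm w ^ k" for k
  proof -
    have "norm (of_nat (k + 1) / of_nat (k + 2) :: complex) \<le> 1"
      unfolding norm_divide norm_of_nat by simp
    then show ?thesis
      using mult_right_mono[of _ 1 "norm w ^ k"]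
      by (simp only: norm_mult norm_power real_norm_def abs_mult abs_norm_cancel
          zero_le_power norm_ge_zero mult_1 power_abs)
  qed
qed

lemma log_series_has_derivative:
  assumes "norm w < 1"
  shows "(log_series has_field_derivative (\<Sum>k. of_nat (k + 1) / of_nat (k + 2) * w ^ k)) (at w)"
proof -
  have "summable (\<lambda>k. 1 / of_nat (Suc k) * z ^ k)" if z: "norm z < 1" for z :: complex
  proof (rule summable_comparison_test')
    show "summable (\<lambda>k. norm z ^ k)" using z by (simp add: summable_geometric)
    show "norm (1 / of_nat (Suc k) * z ^ k) \<le> norm z ^ k" for k
      using mult_right_mono[of "1 / real (Suc k)" 1 "norm z ^ k"]
      by (simp add: norm_mult norm_power norm_divide del: of_nat_Suc)
  qed
  from termdiffs_strong'[OF this assms]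
  have "((\<lambda>w. \<Sum>k. 1 / of_nat (Suc k) * w ^ k) has_field_derivative
      (\<Sum>k. diffs (\<lambda>k. 1 / of_nat (Suc k)) k * w ^ k)) (at w)" .
  then show ?thesis
    unfolding log_series_def[abs_def] diffs_def by simp
qed

text \<open>
  By the recurrence, the Cauchy product turns into \<open>G' = \<alpha> H' G\<close> for the generating function \<open>G\<close> and
  \<open>H = log_series\<close>. So \<open>G exp (- \<alpha> H)\<close> has derivative zero on the unit disc.
\<close>

lemma p_poly_generating_function:
  assumes w: "norm w < 1"
  shows "(\<lambda>n. p_poly n \<alpha> * w ^ n) sums exp (\<alpha> * (log_series w - 1))"
proof -
  define G where "G = (\<lambda>w. \<Sum>n. p_poly n \<alpha> * w ^ n)"
  define H' where "H' = (\<lambda>w::complex. \<Sum>k. of_nat (k + 1) / of_nat (k + 2) * w ^ k)"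
  have summ: "summable (\<lambda>n. p_poly n \<alpha> * z ^ n)" if "norm z < 1" for z
    using summable_norm_cancel[OF summable_norm_p_poly[OF that]] .
  have G': "(G has_field_derivative \<alpha> * H' z * G z) (at z)" if z: "norm z < 1" for z
  proof -
    have "(\<lambda>n. \<Sum>k\<le>n. (of_nat (k + 1) / of_nat (k + 2) * z ^ k) * (p_poly (n - k) \<alpha> * z ^ (n - k)))
        sums (H' z * G z)"
      unfolding H'_def G_def
      by (rule Cauchy_product_sums[OF summable_log_series_deriv[OF z] summable_norm_p_poly[OF z]])
    then have "(\<lambda>n. \<alpha> * (\<Sum>k\<le>n. (of_nat (k + 1) / of_nat (k + 2) * z ^ k) * (p_poly (n - k) \<alpha> * z ^ (n - k))))
        sums (\<alpha> * (H' z * G z))"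
      by (rule sums_mult)
    also have "(\<lambda>n. \<alpha> * (\<Sum>k\<le>n. (of_nat (k + 1) / of_nat (k + 2) * z ^ k) * (p_poly (n - k) \<alpha> * z ^ (n - k))))
        = (\<lambda>n. diffs (\<lambda>n. p_poly n \<alpha>) n * z ^ n)"
    proof
      fix n
      have "(\<Sum>k\<le>n. (of_nat (k + 1) / of_nat (k + 2) * z ^ k) * (p_poly (n - k) \<alpha> * z ^ (n - k)))
         = (\<Sum>k\<le>n. of_nat (k + 1) / of_nat (k + 2) * p_poly (n - k) \<alpha>) * z ^ n"
        unfolding sum_distrib_right
      proof (rule sum.cong[OF refl])
        fix k assume "k \<in> {..n}"
        then have "z ^ n = z ^ k * z ^ (n - k)" by (simp flip: power_add)
        then show "(of_nat (k + 1) / of_nat (k + 2) * z ^ k) * (p_poly (n - k) \<alpha> * z ^ (n - k)) =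
            of_nat (k + 1) / of_nat (k + 2) * p_poly (n - k) \<alpha> * z ^ n"
          by (simp only: mult_ac)
      qed
      then show "\<alpha> * (\<Sum>k\<le>n. (of_nat (k + 1) / of_nat (k + 2) * z ^ k) * (p_poly (n - k) \<alpha> * z ^ (n - k)))
         = diffs (\<lambda>n. p_poly n \<alpha>) n * z ^ n"
        unfolding diffs_def p_poly_recurrence by (simp only: mult.assoc)
    qed
    finally have "(\<Sum>n. diffs (\<lambda>n. p_poly n \<alpha>) n * z ^ n) = \<alpha> * H' z * G z"
      by (simp add: sums_iff mult.assoc)
    then show ?thesis
      using termdiffs_strong'[of 1 "\<lambda>n. p_poly n \<alpha>" z] summ z unfolding G_def by simp
  qed
  have "((\<lambda>z. G z * exp (- \<alpha> * log_series z)) has_field_derivative 0) (at z within ball 0 1)"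
    if "z \<in> ball 0 1" for z
  proof -
    have z: "norm z < 1" using that by simp
    have "((\<lambda>z. G z * exp (- \<alpha> * log_series z)) has_field_derivative
       \<alpha> * H' z * G z * exp (- \<alpha> * log_series z) + exp (- \<alpha> * log_series z) * (- \<alpha> * H' z) * G z) (at z)"
      using G'[OF z] log_series_has_derivative[OF z] unfolding H'_def
      by (auto intro!: derivative_eq_intros)
    moreover have "\<alpha> * H' z * G z * exp (- \<alpha> * log_series z) + exp (- \<alpha> * log_series z) * (- \<alpha> * H' z) * G z = 0"
      by algebra
    ultimately show ?thesis
      using has_field_derivative_at_within by fastforce
  qed
  then obtain c where c: "\<And>z. z \<in> ball 0 1 \<Longrightarrow> G z * exp (- \<alpha> * log_series z) = c"
    using has_field_derivative_zero_constant[of "ball 0 1" "\<lambda>z. G z * exp (- \<alpha> * log_series z)"]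
    by (auto simp: convex_ball)
  have "G 0 = 1" "log_series 0 = 1"
    unfolding G_def log_series_def using powser_zero[of "\<lambda>n. p_poly n \<alpha>"]
      powser_zero[of "\<lambda>k. 1 / of_nat (Suc k) :: complex"] by simp_all
  then have "G w * exp (- \<alpha> * log_series w) = exp (- \<alpha>)"
    using c[of 0] c[of w] w by simp
  then have "G w = exp (- \<alpha>) * exp (\<alpha> * log_series w)"
    by (simp add: exp_minus field_simps)
  also have "\<dots> = exp (\<alpha> * (log_series w - 1))"
    by (simp add: algebra_simps flip: exp_add)
  finally show ?thesis
    using summable_sums[OF summ[OF w]] unfolding G_def by simp
qed

section \<open>Alternating exponential generating functions and complete monotonicity\<close>

text \<open>
  If \<open>a\<close> is the moment sequence of a measure, this is the Laplace transform of the measure; the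
  signs are chosen so that differentiation is, up to sign, a shift of the sequence.
\<close>

definition egf :: "(nat \<Rightarrow> complex) \<Rightarrow> complex \<Rightarrow> complex" where
  "egf a s = (\<Sum>k. (- 1) ^ k * a k / fact k * s ^ k)"

definition shift_seq :: "nat \<Rightarrow> (nat \<Rightarrow> complex) \<Rightarrow> nat \<Rightarrow> complex" where
  "shift_seq n a k = a (n + k)"

lemma shift_seq_Suc: "shift_seq (Suc 0) (shift_seq n a) = shift_seq (Suc n) a"
  by (simp add: shift_seq_def fun_eq_iff)

text \<open>
  At most geometric growth is what makes \<open>egf a\<close> entire, and it is preserved by shifts.
\<close>

definition exp_bounded :: "(nat \<Rightarrow> complex) \<Rightarrow> bool" where
  "exp_bounded a \<longleftrightarrow> (\<exists>M B. \<forall>n. norm (a n) \<le> M * B ^ n)"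

lemma exp_bounded_shift:
  assumes "exp_bounded a"
  shows "exp_bounded (shift_seq n a)"
proof -
  obtain M B where MB: "\<And>n. norm (a n) \<le> M * B ^ n" using assms by (auto simp: exp_bounded_def)
  have "norm (shift_seq n a k) \<le> (M * B ^ n) * B ^ k" for k
    using MB[of "n + k"] by (simp add: shift_seq_def power_add mult.assoc)
  then show ?thesis unfolding exp_bounded_def by blast
qed

lemma summable_egf:
  assumes "exp_bounded a"
  shows "summable (\<lambda>k. norm ((- 1) ^ k * a k / fact k * s ^ k))"
proof -
  obtain M B where MB: "\<And>n. norm (a n) \<le> M * B ^ n" using assms by (auto simp: exp_bounded_def)
  have "summable (\<lambda>k. M * ((B * norm s) ^ k /\<^sub>R fact k))"
    by (intro summable_mult summable_exp_generic)
  then show ?thesis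
  proof (rule summable_comparison_test')
    fix k
    have "norm (a k) * (norm s ^ k / fact k) \<le> M * B ^ k * (norm s ^ k / fact k)"
      by (intro mult_right_mono MB) simp
    then show "norm (norm ((- 1) ^ k * a k / fact k * s ^ k)) \<le> M * ((B * norm s) ^ k /\<^sub>R fact k)"
      by (simp add: norm_mult norm_divide norm_power power_mult_distrib field_simps)
  qed
qed

lemma egf_has_derivative:
  assumes "exp_bounded a"
  shows "(egf a has_field_derivative - egf (shift_seq (Suc 0) a) s) (at s)"
proof -
  have "((\<lambda>s. \<Sum>k. (- 1) ^ k * a k / fact k * s ^ k) has_field_derivative
      (\<Sum>k. diffs (\<lambda>k. (- 1) ^ k * a k / fact k) k * s ^ k)) (at s)"
    by (rule termdiffs_strong_converges_everywhere) (rule summable_norm_cancel[OF summable_egf[OF assms]])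
  moreover have "diffs (\<lambda>k. (- 1) ^ k * a k / fact k) k * s ^ k =
      - ((- 1) ^ k * shift_seq (Suc 0) a k / fact k * s ^ k)" for k
    by (simp add: diffs_def shift_seq_def divide_simps del: of_nat_Suc)
  ultimately show ?thesis
    unfolding egf_def[abs_def] using suminf_minus[OF summable_norm_cancel[OF summable_egf[OF exp_bounded_shift[OF assms]]]]
    by simp
qed

lemma egf_deriv_iter:
  assumes "exp_bounded a"
  shows "(deriv ^^ n) (egf a) = (\<lambda>s. (- 1) ^ n * egf (shift_seq n a) s)"
proof (induction n)
  case (Suc n)
  show ?case
  proof
    fix s
    have "((\<lambda>s. (- 1) ^ n * egf (shift_seq n a) s) has_field_derivative
        (- 1) ^ n * (- egf (shift_seq (Suc n) a) s)) (at s)"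
      using DERIV_cmult[OF egf_has_derivative[OF exp_bounded_shift[OF assms, of n]]]
      by (simp add: shift_seq_Suc)
    then show "(deriv ^^ Suc n) (egf a) s = (- 1) ^ Suc n * egf (shift_seq (Suc n) a) s"
      using Suc by (simp add: DERIV_imp_deriv)
  qed
qed (simp add: shift_seq_def[abs_def])

lemma has_real_derivative_Re_egf:
  assumes "exp_bounded a"
  shows "((\<lambda>x. Re (egf a (of_real x))) has_real_derivative - Re (egf (shift_seq (Suc 0) a) (of_real x))) (at x)"
  using has_field_derivative_Re[OF has_vector_derivative_real_field[OF egf_has_derivative[OF assms]]]
  by simp

lemma Re_egf_deriv_iter:
  assumes "exp_bounded a"
  shows "(deriv ^^ n) (\<lambda>x. Re (egf a (of_real x))) = (\<lambda>x. (- 1) ^ n * Re (egf (shift_seq n a) (of_real x)))"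
proof (induction n)
  case (Suc n)
  show ?case
  proof
    fix x :: real
    have "((\<lambda>x. (- 1) ^ n * Re (egf (shift_seq n a) (of_real x))) has_field_derivative
        (- 1) ^ n * (- Re (egf (shift_seq (Suc n) a) (of_real x)))) (at x)"
      using DERIV_cmult[OF has_real_derivative_Re_egf[OF exp_bounded_shift[OF assms, of n]]]
      by (simp add: shift_seq_Suc)
    then show "(deriv ^^ Suc n) (\<lambda>x. Re (egf a (of_real x))) x = (- 1) ^ Suc n * Re (egf (shift_seq (Suc n) a) (of_real x))"
      using Suc by (simp add: DERIV_imp_deriv)
  qed
qed (simp add: shift_seq_def[abs_def])

lemma egf_0: "egf a 0 = a 0"
  unfolding egf_def using powser_zero[of "\<lambda>k. (- 1) ^ k * a k / fact k"] by simp

lemma tendsto_egf_at_right_0: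
  assumes "exp_bounded a"
  shows "((\<lambda>x. egf a (of_real x)) \<longlongrightarrow> a 0) (at_right 0)"
proof -
  have "isCont (egf a) (of_real 0)"
    by (rule DERIV_isCont[OF egf_has_derivative[OF assms]])
  then have "isCont (\<lambda>x::real. egf a (of_real x)) 0"
    by (intro isCont_o2[where f = of_real and g = "egf a"]) auto
  then show ?thesis
    unfolding isCont_def by (auto simp: egf_0 elim: filterlim_mono simp: at_le)
qed

text \<open>
  The derivatives of \<open>egf a\<close> are the shifted functions. Reality of the function alone propagates to
  all of them, because the derivative of a vanishing imaginary part vanishes.
\<close>

lemma completely_monotonic_egf_iff:
  assumes a: "exp_bounded a"
  shows "completely_monotonic (\<lambda>x. egf a (of_real x)) \<longleftrightarrow>
    (\<forall>n. \<forall>x>0. egf (shift_seq n a) (of_real x) \<in> \<real> \<and> 0 \<le> Re (egf (shift_seq n a) (of_real x)))"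
proof -
  have sgn: "(- 1) ^ n * ((- 1) ^ n * y) = y" for n and y :: real
    by (simp add: mult.assoc[symmetric] flip: power_mult_distrib)
  have diff: "(\<lambda>x. (- 1) ^ n * Re (egf (shift_seq n a) (of_real x))) field_differentiable (at x)" for n and x :: real
    using DERIV_cmult[OF has_real_derivative_Re_egf[OF exp_bounded_shift[OF a, of n]]]
    unfolding field_differentiable_def by blast
  have "completely_monotonic (\<lambda>x. egf a (of_real x)) \<longleftrightarrow>
    (\<forall>x>0. egf a (of_real x) \<in> \<real>) \<and> (\<forall>n. \<forall>x>0. 0 \<le> Re (egf (shift_seq n a) (of_real x)))"
    unfolding completely_monotonic_def Re_egf_deriv_iter[OF a] sgn using diff by simp
  moreover have "egf (shift_seq n a) (of_real x) \<in> \<real>"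
    if real: "\<forall>x>0. egf a (of_real x) \<in> \<real>" and "x > 0" for n and x :: real
    using \<open>x > 0\<close>
  proof (induction n arbitrary: x)
    case 0
    have "shift_seq 0 a = a" by (simp add: shift_seq_def fun_eq_iff)
    then show ?case using real 0 by simp
  next
    case (Suc n)
    have "((\<lambda>x. Im (egf (shift_seq n a) (of_real x))) has_real_derivative
        - Im (egf (shift_seq (Suc n) a) (of_real x))) (at x)"
      using has_field_derivative_Im[OF has_vector_derivative_real_field[OF egf_has_derivative[OF exp_bounded_shift[OF a, of n]]]]
      by (simp add: shift_seq_Suc)
    moreover have "((\<lambda>x. Im (egf (shift_seq n a) (of_real x))) has_real_derivative 0) (at x)"
    proof (rule has_field_derivative_transform_within_open[where S = "{0<..}" and f = "\<lambda>_. 0"])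
      show "0 = Im (egf (shift_seq n a) (of_real y))" if "y \<in> {0<..}" for y
        using Suc.IH[of y] that by (simp add: complex_is_Real_iff)
    qed (use Suc.prems in auto)
    ultimately show ?case
      using DERIV_unique by (fastforce simp: complex_is_Real_iff)
  qed
  moreover have "shift_seq 0 a = a" by (simp add: shift_seq_def fun_eq_iff)
  ultimately show ?thesis by metis
qed

text \<open>
  Expand at \<open>T\<close> and evaluate at 0. With the nonnegative weights
  \<open>w\<^sub>m = (-1)\<^sup>m f\<^sup>(\<^sup>m\<^sup>)(T) T\<^sup>m / m!\<close>, where \<open>f = egf a\<close>, this reads
  \<open>a\<^sub>0 = \<Sum> w\<^sub>m\<close>, \<open>a\<^sub>1 = \<Sum> (m/T) w\<^sub>m\<close> and \<open>a\<^sub>2 = \<Sum> (m/T) ((m - 1)/T) w\<^sub>m\<close>. So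
  \<open>a\<^sub>2 + a\<^sub>1/T - 2 l a\<^sub>1 + l\<^sup>2 a\<^sub>0 = \<Sum> (m/T - l)\<^sup>2 w\<^sub>m \<ge> 0\<close>, and the term \<open>a\<^sub>1/T\<close> disappears as \<open>T\<close> grows.
\<close>

lemma egf_nonneg_imp_log_convex:
  assumes a: "exp_bounded a"
    and pos: "\<And>n x. x > 0 \<Longrightarrow> 0 \<le> Re (egf (shift_seq n a) (of_real x))"
  shows "0 \<le> Re (a 2) - 2 * l * Re (a 1) + l\<^sup>2 * Re (a 0)"
proof -
  have taylor: "(\<lambda>m. Re (egf (shift_seq (n + m) a) (of_real T)) / fact m * T ^ m) sums Re (a n)" if "T > 0" for n T
  proof -
    have Re_mult: "Re (of_real c * z) = c * Re z" for c z by simp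
    have hol: "egf (shift_seq n a) holomorphic_on ball (of_real T) (2 * T)"
      using egf_has_derivative[OF exp_bounded_shift[OF a, of n]]
      by (meson field_differentiable_at_within field_differentiable_def holomorphic_on_def)
    have "(\<lambda>m. (deriv ^^ m) (egf (shift_seq n a)) (of_real T) / fact m * (0 - of_real T) ^ m)
        sums egf (shift_seq n a) 0"
      by (rule holomorphic_power_series[OF hol]) (use that in simp)
    moreover have "shift_seq m (shift_seq n a) = shift_seq (n + m) a" for m
      by (simp add: shift_seq_def fun_eq_iff add.assoc)
    moreover have "(- 1) ^ m * z / fact m * (0 - of_real T) ^ m = of_real (T ^ m / fact m) * z" for m and z :: complex
      by (simp add: power_minus[of "complex_of_real T"] flip: power_add mult_2) 
    ultimately have "(\<lambda>m. of_real (T ^ m / fact m) * egf (shift_seq (n + m) a) (of_real T)) sums a n"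
      by (simp only: egf_deriv_iter[OF exp_bounded_shift[OF a]] egf_0) (simp add: shift_seq_def)
    from sums_Re[OF this] show ?thesis by (simp only: Re_mult) (simp add: mult.commute)
  qed
  have key: "0 \<le> Re (a 2) - 2 * l * Re (a 1) + l\<^sup>2 * Re (a 0) + Re (a 1) / T" if T: "T > 0" for T
  proof -
    define w where "w = (\<lambda>m. Re (egf (shift_seq m a) (of_real T)) / fact m * T ^ m)"
    have 0: "w sums Re (a 0)"
      using taylor[OF T, of 0] by (simp add: w_def)
    \<comment> \<open>The factor \<open>m\<close> kills the term \<open>m = 0\<close>, so the series may be summed from 1 on, where \<open>m / m!\<close> cancels.\<close>
    have "(\<lambda>m. real (Suc m) / T * w (Suc m)) = (\<lambda>m. Re (egf (shift_seq (1 + m) a) (of_real T)) / fact m * T ^ m)"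
      using T by (auto simp: w_def fun_eq_iff field_simps simp del: of_nat_Suc)
    then have "(\<lambda>m. real (Suc m) / T * w (Suc m)) sums Re (a 1)"
      using taylor[OF T, of 1] by simp
    then have 1: "(\<lambda>m. real m / T * w m) sums Re (a 1)"
      by (subst (asm) sums_Suc_iff) simp
    have "(\<lambda>m. real (Suc (Suc m)) / T * (real (Suc m) / T) * w (Suc (Suc m)))
       = (\<lambda>m. Re (egf (shift_seq (2 + m) a) (of_real T)) / fact m * T ^ m)"
      using T by (auto simp: w_def fun_eq_iff divide_simps simp del: of_nat_Suc)
    then have "(\<lambda>m. real (Suc (Suc m)) / T * (real (Suc m) / T) * w (Suc (Suc m))) sums Re (a 2)"
      using taylor[OF T, of 2] by simp
    then have "(\<lambda>m. real (Suc m) / T * (real m / T) * w (Suc m)) sums Re (a 2)"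
      by (subst (asm) sums_Suc_iff) simp
    then have 2: "(\<lambda>m. real m / T * (real (m - 1) / T) * w m) sums Re (a 2)"
      using sums_Suc_iff[of "\<lambda>m. real m / T * (real (m - 1) / T) * w m"] by simp
    have "(\<lambda>m. real m / T * (real (m - 1) / T) * w m - 2 * l * (real m / T * w m) + l\<^sup>2 * w m + real m / T * w m / T)
      sums (Re (a 2) - 2 * l * Re (a 1) + l\<^sup>2 * Re (a 0) + Re (a 1) / T)"
      by (intro sums_add sums_diff sums_mult sums_divide 0 1 2)
    moreover have "real m / T * (real (m - 1) / T) * w m - 2 * l * (real m / T * w m) + l\<^sup>2 * w m + real m / T * w m / T
       = (real m / T - l)\<^sup>2 * w m" for m
      using T by (cases m) (simp_all add: field_simps power2_eq_square)
    ultimately have sums: "(\<lambda>m. (real m / T - l)\<^sup>2 * w m)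
      sums (Re (a 2) - 2 * l * Re (a 1) + l\<^sup>2 * Re (a 0) + Re (a 1) / T)"
      by (simp only:)
    have "0 \<le> (real m / T - l)\<^sup>2 * w m" for m
      using pos[OF T] T by (simp add: w_def)
    then show ?thesis by (rule sums_le[OF _ sums_zero sums])
  qed
  have "((\<lambda>T. Re (a 2) - 2 * l * Re (a 1) + l\<^sup>2 * Re (a 0) + Re (a 1) / T) \<longlongrightarrow>
      Re (a 2) - 2 * l * Re (a 1) + l\<^sup>2 * Re (a 0) + 0) at_top"
    by (intro tendsto_intros tendsto_divide_0[OF tendsto_const] filterlim_at_top_imp_at_infinity filterlim_ident)
  then show ?thesis
    using tendsto_lowerbound[where a = 0] eventually_gt_at_top[of 0] key
    by (metis (mono_tags, lifting) add.right_neutral eventually_mono trivial_limit_at_top_linorder)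
qed

section \<open>The contour integral as a power series\<close>

text \<open>
  Substituting \<open>w = -1/z\<close> turns \<open>z Ln (1 + 1/z)\<close> into \<open>log_series w\<close>.
\<close>

lemma f_alpha_laurent:
  assumes z: "norm z > 1"
  shows "(\<lambda>n. exp \<alpha> * ((- 1) ^ n * p_poly (Suc n) \<alpha>) / z ^ Suc n) sums f_alpha \<alpha> z"
proof -
  define w where "w = - 1 / z"
  have "z \<noteq> 0" using z by auto
  then have w: "norm w < 1" "w \<noteq> 0" using z by (auto simp: w_def norm_divide)
  have "log_series w = z * Ln (1 + 1 / z)"
    using log_series_eq_Ln[OF w] by (simp add: w_def)
  then have "exp (\<alpha> * (log_series w - 1)) = exp (\<alpha> * z * Ln (1 + 1 / z)) / exp \<alpha>"
    by (simp add: algebra_simps exp_diff)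
  with p_poly_generating_function[OF w(1), of \<alpha>]
  have "(\<lambda>n. p_poly n \<alpha> * w ^ n) sums (exp (\<alpha> * z * Ln (1 + 1 / z)) / exp \<alpha>)" by simp
  then have "(\<lambda>n. p_poly (Suc n) \<alpha> * w ^ Suc n) sums (exp (\<alpha> * z * Ln (1 + 1 / z)) / exp \<alpha> - 1)"
    by (subst sums_Suc_iff) simp
  then have "(\<lambda>n. - exp \<alpha> * (p_poly (Suc n) \<alpha> * w ^ Suc n)) sums
      (- exp \<alpha> * (exp (\<alpha> * z * Ln (1 + 1 / z)) / exp \<alpha> - 1))"
    by (rule sums_mult)
  moreover have "- exp \<alpha> * (exp (\<alpha> * z * Ln (1 + 1 / z)) / exp \<alpha> - 1) = f_alpha \<alpha> z"
    using \<open>z \<noteq> 0\<close> by (simp add: f_alpha_def field_simps)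
  moreover have "- exp \<alpha> * (p_poly (Suc n) \<alpha> * w ^ Suc n) = exp \<alpha> * ((- 1) ^ n * p_poly (Suc n) \<alpha>) / z ^ Suc n" for n
    using \<open>z \<noteq> 0\<close> unfolding w_def power_divide by (simp del: p_poly.simps)
  ultimately show ?thesis by (simp only:)
qed

definition slit_plane :: "complex set" where
  "slit_plane = - closed_segment (- 1) 0"

lemma slit_plane_iff: "z \<in> slit_plane \<longleftrightarrow> Im z \<noteq> 0 \<or> Re z < - 1 \<or> Re z > 0"
proof -
  have "closed_segment (- 1) 0 = complex_of_real ` closed_segment (- 1) 0"
    using closed_segment_of_real[of "- 1" 0] by simp
  also have "\<dots> = complex_of_real ` {- 1..0}" by (simp add: closed_segment_eq_real_ivl)
  finally have "z \<in> closed_segment (- 1) 0 \<longleftrightarrow> (\<exists>x\<in>{- 1..0}. z = complex_of_real x)"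
    by blast
  also have "\<dots> \<longleftrightarrow> Im z = 0 \<and> - 1 \<le> Re z \<and> Re z \<le> 0"
    by (auto simp: complex_eq_iff intro: bexI[of _ "Re z"])
  finally show ?thesis unfolding slit_plane_def by auto
qed

lemma open_slit_plane: "open slit_plane"
  unfolding slit_plane_def by (simp add: open_Compl)

lemma f_alpha_holomorphic: "f_alpha \<alpha> holomorphic_on slit_plane"
proof -
  have "1 + 1 / z \<notin> \<real>\<^sub>\<le>\<^sub>0" if z: "z \<in> slit_plane" for z
  proof
    assume "1 + 1 / z \<in> \<real>\<^sub>\<le>\<^sub>0"
    then obtain t where t: "t \<le> 0" "1 + 1 / z = of_real t"
      by (auto elim!: nonpos_Reals_cases)
    have "z \<noteq> 0" using z by (auto simp: slit_plane_iff)
    have "1 / z = of_real (t - 1)" using t(2) by (simp add: algebra_simps)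
    then have "1 / (1 / z) = 1 / of_real (t - 1)" by simp
    then have "z = of_real (1 / (t - 1))" by simp
    moreover have "- 1 \<le> 1 / (t - 1)" "1 / (t - 1) \<le> 0" using t(1) by (simp_all add: divide_simps)
    ultimately show False using z by (simp add: slit_plane_iff)
  qed
  then have "(\<lambda>z. exp \<alpha> - exp (\<alpha> * z * Ln (1 + 1 / z))) holomorphic_on slit_plane"
    by (intro holomorphic_intros) (auto simp: slit_plane_iff)
  then show ?thesis
    by (rule holomorphic_transform) (auto simp: f_alpha_def slit_plane_iff)
qed

text \<open>
  Near 0 the number \<open>1 + 1/z\<close> has modulus at least 1, so the real part of its logarithm is between 0
  and \<open>ln (1 + 1/\<bar>z\<bar>)\<close>, while the imaginary part is at most \<open>\<pi>\<close> in modulus on every side of the cut.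
\<close>

lemma tendsto_z_Ln_0: "((\<lambda>z. z * Ln (1 + 1 / z)) \<longlongrightarrow> 0) (at 0)"
proof (rule Lim_null_comparison)
  have "((\<lambda>x::real. x * (ln (1 + 1 / x) + pi)) \<longlongrightarrow> 0) (at_right 0)"
    by real_asymp
  moreover have "filterlim (\<lambda>z::complex. norm z) (at_right 0) (at 0)"
    by (simp add: filterlim_at tendsto_norm_zero eventually_at_filter)
  ultimately show "((\<lambda>z::complex. norm z * (ln (1 + 1 / norm z) + pi)) \<longlongrightarrow> 0) (at 0)"
    by (rule filterlim_compose)
  have "norm (z * Ln (1 + 1 / z)) \<le> norm z * (ln (1 + 1 / norm z) + pi)"
    if z: "z \<noteq> 0" "norm z < 1 / 2" for z
  proof -
    have "norm (1 / z) > 2" using z by (simp add: norm_divide field_simps)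
    then have lo: "norm (1 + 1 / z) \<ge> 1"
      using norm_diff_ineq[of "1 / z" 1] by (simp add: add.commute)
    then have nz: "1 + 1 / z \<noteq> 0" by auto
    have "norm (1 + 1 / z) \<le> 1 + 1 / norm z"
      using norm_triangle_ineq[of 1 "1 / z"] by (simp add: norm_divide)
    then have "\<bar>Re (Ln (1 + 1 / z))\<bar> \<le> ln (1 + 1 / norm z)"
      using lo nz by (simp add: Re_Ln ln_mono)
    moreover have "\<bar>Im (Ln (1 + 1 / z))\<bar> \<le> pi"
      using mpi_less_Im_Ln[OF nz] Im_Ln_le_pi[OF nz] by linarith
    ultimately have "norm (Ln (1 + 1 / z)) \<le> ln (1 + 1 / norm z) + pi"
      using cmod_le[of "Ln (1 + 1 / z)"] by linarith
    then show ?thesis by (simp add: norm_mult mult_left_mono)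
  qed
  then show "\<forall>\<^sub>F z in at 0. norm (z * Ln (1 + 1 / z)) \<le> norm z * (ln (1 + 1 / norm z) + pi)"
    unfolding eventually_at by (intro exI[of _ "1 / 2"]) (auto simp: dist_norm)
qed

lemma isCont_f_alpha_0: "isCont (f_alpha \<alpha>) 0"
proof -
  have "((\<lambda>z. exp \<alpha> - exp (\<alpha> * (z * Ln (1 + 1 / z)))) \<longlongrightarrow> exp \<alpha> - exp (\<alpha> * 0)) (at 0)"
    by (intro tendsto_intros tendsto_z_Ln_0)
  then have "(f_alpha \<alpha> \<longlongrightarrow> exp \<alpha> - exp (\<alpha> * 0)) (at 0)"
    by (rule Lim_transform_eventually) (auto simp: f_alpha_def eventually_at_filter mult.assoc)
  then show ?thesis by (simp add: isCont_def f_alpha_def)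
qed

lemma contour_integral_rectpath:
  assumes "continuous_on (path_image (rectpath a b)) f"
  shows "contour_integral (rectpath a b) f =
    contour_integral (linepath a (Complex (Re b) (Im a))) f +
    contour_integral (linepath (Complex (Re b) (Im a)) b) f +
    contour_integral (linepath b (Complex (Re a) (Im b))) f +
    contour_integral (linepath (Complex (Re a) (Im b)) a) f"
proof -
  have "f contour_integrable_on linepath a (Complex (Re b) (Im a))"
    "f contour_integrable_on linepath (Complex (Re b) (Im a)) b"
    "f contour_integrable_on linepath b (Complex (Re a) (Im b))"
    "f contour_integrable_on linepath (Complex (Re a) (Im b)) a"
    by (intro contour_integrable_continuous_linepath continuous_on_subset[OF assms];
        simp add: rectpath_def path_image_join Let_def; blast)+
  then show ?thesis
    unfolding rectpath_def Let_def
    by (simp add: contour_integral_join contour_integrable_join add.assoc)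
qed

text \<open>
  The right side of the contour meets the cut in its end point 0, where \<open>g\<close> is only continuous. Gluing
  on the rectangle between real parts 0 and 1, over whose boundary \<open>g\<close> integrates to 0 by Cauchy's
  theorem, moves this side off the cut.
\<close>

lemma rect_contour_shift:
  assumes "r > 0" "c > 1"
    and hol: "g holomorphic_on slit_plane" and cont: "continuous_on (insert 0 slit_plane) g"
  shows "contour_integral (rect_contour r c) g = contour_integral (rectpath (Complex (- c) (- r)) (Complex 1 r)) g"
proof -
  \<comment> \<open>The corners \<open>a, p, q, d\<close> of the given rectangle are joined on the right by \<open>P\<close> and \<open>Q\<close>.\<close>
  define a p q d P Q where "a = Complex (- c) (- r)" and "p = Complex 0 (- r)" and "q = Complex 0 r"
    and "d = Complex (- c) r" and "P = Complex 1 (- r)" and "Q = Complex 1 r"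
  note defs = a_def p_def q_def d_def P_def Q_def
  define I where "I = (\<lambda>x y. contour_integral (linepath x y) g)"
  have sub: "path_image (rectpath a q) \<subseteq> insert 0 slit_plane" "path_image (rectpath a Q) \<subseteq> insert 0 slit_plane"
    "path_image (rectpath p Q) \<subseteq> insert 0 slit_plane"
    using assms(1,2) unfolding defs
    by (auto simp: path_image_rectpath slit_plane_iff complex_eq_iff)
  have left: "contour_integral (rectpath a q) g = I a p + I p q + I q d + I d a"
    using contour_integral_rectpath[OF continuous_on_subset[OF cont sub(1)]] by (simp add: defs I_def)
  have big: "contour_integral (rectpath a Q) g = I a P + I P Q + I Q d + I d a"
    using contour_integral_rectpath[OF continuous_on_subset[OF cont sub(2)]] by (simp add: defs I_def)
  have right: "contour_integral (rectpath p Q) g = I p P + I P Q + I Q q + I q p"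
    using contour_integral_rectpath[OF continuous_on_subset[OF cont sub(3)]] by (simp add: defs I_def)
  have "(g has_contour_integral 0) (rectpath p Q)"
  proof (rule Cauchy_theorem_convex[where S = "{z. 0 \<le> Re z}" and K = "{0}"])
    show "continuous_on {z. 0 \<le> Re z} g"
      by (rule continuous_on_subset[OF cont]) (auto simp: slit_plane_iff complex_eq_iff)
    show "g field_differentiable at z" if "z \<in> interior {z. 0 \<le> Re z} - {0}" for z
    proof -
      have "0 \<le> Re z" "z \<noteq> 0" using that interior_subset by auto
      then have "z \<in> slit_plane" by (auto simp: slit_plane_iff complex_eq_iff)
      then show ?thesis using hol open_slit_plane holomorphic_on_imp_differentiable_at by blast
    qed
    show "path_image (rectpath p Q) \<subseteq> {z. 0 \<le> Re z}"
      using assms(1) by (auto simp: path_image_rectpath defs)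
  qed (auto simp: convex_halfspace_Re_ge)
  then have zero: "contour_integral (rectpath p Q) g = 0" by (rule contour_integral_unique)
  have seg: "closed_segment a P \<subseteq> insert 0 slit_plane" "closed_segment Q d \<subseteq> insert 0 slit_plane"
    "closed_segment p q \<subseteq> insert 0 slit_plane"
    using sub by (auto simp: rectpath_def path_image_join Let_def defs)
  have "p \<in> closed_segment a P" "q \<in> closed_segment Q d"
    using assms(1,2) by (auto simp: defs closed_segment_same_Im closed_segment_eq_real_ivl)
  then have split: "I a P = I a p + I p P" "I Q d = I Q q + I q d"
    unfolding I_def using seg by (auto intro!: contour_integral_split_linepath continuous_on_subset[OF cont])
  have "I q p = - I p q"
    unfolding I_def using contour_integral_reverse_linepath[OF continuous_on_subset[OF cont seg(3)]] by simp
  then have "I p P + I P Q + I Q q = I p q"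
    using right zero by simp
  then have "contour_integral (rectpath a q) g = contour_integral (rectpath a Q) g"
    unfolding left big split by (simp add: algebra_simps)
  then show ?thesis unfolding rect_contour_def defs .
qed

text \<open>
  Both closed paths wind once around every point of the cut. To apply the homology form of Cauchy's
  theorem to a single closed path, run through the rectangle, go to the circle along a segment, run
  through the circle backwards and return.
\<close>

lemma rectpath_to_circlepath:
  assumes "r > 0" "c > 1" and hol: "g holomorphic_on slit_plane"
  shows "contour_integral (rectpath (Complex (- c) (- r)) (Complex 1 r)) g = contour_integral (circlepath 0 2) g"
proof -
  define R where "R = rectpath (Complex (- c) (- r)) (Complex 1 r)"
  define l where "l = linepath (Complex (- c) (- r)) 2"
  define C where "C = circlepath 0 2"
  define \<gamma> where "\<gamma> = R +++ l +++ reversepath C +++ reversepath l"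
  have ends [simp]: "pathstart R = Complex (- c) (- r)" "pathfinish R = Complex (- c) (- r)"
    "pathstart l = Complex (- c) (- r)" "pathfinish l = 2" "pathstart C = 2" "pathfinish C = 2"
    by (simp_all add: R_def l_def C_def)
  have valid [simp]: "valid_path R" "valid_path l" "valid_path C"
    by (simp_all add: R_def l_def C_def)
  then have path [simp]: "path R" "path l" "path C" by (simp_all add: valid_path_imp_path)
  have imR: "path_image R \<subseteq> slit_plane"
    using assms(1,2) by (auto simp: R_def path_image_rectpath slit_plane_iff)
  have imC: "path_image C \<subseteq> slit_plane"
  proof
    fix z assume "z \<in> path_image C"
    then have "norm z = 2" by (simp add: C_def)
    then show "z \<in> slit_plane"
      using cmod_le[of z] by (auto simp: slit_plane_iff)
  qed
  \<comment> \<open>The segment starts below the real axis and reaches it only at 2.\<close>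
  have iml: "path_image l \<subseteq> slit_plane"
  proof
    fix z assume "z \<in> path_image l"
    then obtain u where u: "0 \<le> u" "u \<le> 1" "z = (1 - u) *\<^sub>R Complex (- c) (- r) + u *\<^sub>R 2"
      by (auto simp: l_def closed_segment_def)
    show "z \<in> slit_plane"
    proof (cases "u = 1")
      case False
      then have "Im z < 0" using u assms(1) by simp
      then show ?thesis by (simp add: slit_plane_iff)
    qed (use u in \<open>simp add: slit_plane_iff\<close>)
  qed
  have "(g has_contour_integral 0) \<gamma>"
  proof (rule Cauchy_theorem_global[OF open_slit_plane hol])
    show "path_image \<gamma> \<subseteq> slit_plane"
      using imR imC iml by (simp add: \<gamma>_def path_image_join)
    fix w assume w: "w \<notin> slit_plane"
    then have w': "Im w = 0" "- 1 \<le> Re w" "Re w \<le> 0" by (auto simp: slit_plane_iff)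
    have "winding_number R w = 1"
      unfolding R_def using w' assms(1,2) by (intro winding_number_rectpath) (simp add: in_box_complex_iff)
    moreover have "winding_number C w = 1"
      unfolding C_def using w' cmod_le[of w] by (intro winding_number_circlepath) simp
    moreover have "w \<notin> path_image R" "w \<notin> path_image l" "w \<notin> path_image C"
      using w imR imC iml by auto
    ultimately show "winding_number \<gamma> w = 0"
      by (simp add: \<gamma>_def winding_number_join winding_number_reversepath path_image_join)
  qed (simp_all add: \<gamma>_def)
  then have "contour_integral \<gamma> g = 0" by (rule contour_integral_unique)
  moreover have "g contour_integrable_on R" "g contour_integrable_on l" "g contour_integrable_on C"
    using contour_integrable_holomorphic_simple[OF hol open_slit_plane] imR imC iml by simp_all
  ultimately have "contour_integral R g = contour_integral C g"
    by (simp add: \<gamma>_def contour_integral_join contour_integral_reversepath contour_integrable_join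
        contour_integrable_reversepath)
  then show ?thesis by (simp add: R_def C_def)
qed

lemma has_contour_integral_exp_over_power:
  "((\<lambda>u. exp (s * u) / u ^ Suc k) has_contour_integral (2 * pi * \<i> / fact k * s ^ k)) (circlepath 0 2)"
proof -
  have iter: "(deriv ^^ k) (\<lambda>u. exp (s * u)) = (\<lambda>u. s ^ k * exp (s * u))" for k
  proof (induction k)
    case (Suc k)
    have "((\<lambda>u. s ^ k * exp (s * u)) has_field_derivative s ^ Suc k * exp (s * u)) (at u)" for u
      by (auto intro!: derivative_eq_intros)
    then have "deriv (\<lambda>u. s ^ k * exp (s * u)) = (\<lambda>u. s ^ Suc k * exp (s * u))"
      by (auto intro: DERIV_imp_deriv)
    then show ?case using Suc by simp
  qed simp
  have "((\<lambda>u. exp (s * u) / (u - 0) ^ Suc k) has_contour_integral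
      (2 * pi * \<i> / fact k * (deriv ^^ k) (\<lambda>u. exp (s * u)) 0)) (circlepath 0 2)"
    by (rule Cauchy_has_contour_integral_higher_derivative_circlepath)
       (auto intro!: continuous_intros holomorphic_intros)
  then show ?thesis by (simp add: iter)
qed

lemma exp_bounded_p_poly: "exp_bounded (\<lambda>n. C * p_poly (n + 1) \<alpha>)"
proof -
  obtain M where M: "\<And>n. norm (p_poly n \<alpha>) \<le> M * 2 ^ n"
    using p_poly_le_exponential by blast
  have "norm (C * p_poly (n + 1) \<alpha>) \<le> (norm C * M * 2) * 2 ^ n" for n
    using mult_left_mono[OF M[of "n + 1"], of "norm C"] by (simp add: norm_mult mult_ac del: p_poly.simps)
  then show ?thesis unfolding exp_bounded_def by blast
qed

text \<open>
  On the circle of radius 2 the Laurent series of \<open>f_alpha\<close> converges uniformly, and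
  \<open>exp (s z) / z\<^sup>n\<^sup>+\<^sup>1\<close> contributes \<open>s\<^sup>n / n!\<close> by Cauchy's integral formula for derivatives.
\<close>

lemma phi_eq_egf:
  assumes "r > 0" "c > 1"
  shows "phi r c \<alpha> s = egf (\<lambda>n. exp \<alpha> * p_poly (n + 1) \<alpha>) s"
proof -
  define g where "g = (\<lambda>z. f_alpha \<alpha> z * exp (s * z))"
  define T where "T = (\<lambda>n z. exp \<alpha> * ((- 1) ^ n * p_poly (Suc n) \<alpha>) * (exp (s * z) / z ^ Suc n))"
  have hol: "g holomorphic_on slit_plane"
    unfolding g_def by (intro holomorphic_intros f_alpha_holomorphic)
  have "isCont (f_alpha \<alpha>) z" if "z \<in> insert 0 slit_plane" for z
    using that isCont_f_alpha_0[of \<alpha>] f_alpha_holomorphic[of \<alpha>] open_slit_plane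
    by (auto dest: holomorphic_on_imp_continuous_on simp: continuous_on_eq_continuous_at)
  then have cont: "continuous_on (insert 0 slit_plane) g"
    unfolding g_def by (intro continuous_intros continuous_at_imp_continuous_on) auto
  have T: "T n contour_integrable_on circlepath 0 2"
    "contour_integral (circlepath 0 2) (T n) = 2 * pi * \<i> * ((- 1) ^ n * (exp \<alpha> * p_poly (n + 1) \<alpha>) / fact n * s ^ n)" for n
  proof -
    have *: "(T n has_contour_integral exp \<alpha> * ((- 1) ^ n * p_poly (Suc n) \<alpha>) * (2 * pi * \<i> / fact n * s ^ n))
        (circlepath 0 2)"
      unfolding T_def by (rule has_contour_integral_lmul[OF has_contour_integral_exp_over_power])
    then show "T n contour_integrable_on circlepath 0 2" by (auto simp: contour_integrable_on_def)
    show "contour_integral (circlepath 0 2) (T n) = 2 * pi * \<i> * ((- 1) ^ n * (exp \<alpha> * p_poly (n + 1) \<alpha>) / fact n * s ^ n)"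
      using contour_integral_unique[OF *] by (simp add: mult_ac del: p_poly.simps)
  qed
  have unif: "uniform_limit (sphere 0 2) (\<lambda>N z. \<Sum>n<N. T n z) (\<lambda>z. \<Sum>n. T n z) sequentially"
  proof (rule Weierstrass_m_test)
    have "summable (\<lambda>n. norm (p_poly n \<alpha> * (1 / 2) ^ n))"
      by (rule summable_norm_p_poly) simp
    then have "summable (\<lambda>n. norm (p_poly (Suc n) \<alpha> * (1 / 2) ^ Suc n))"
      by (subst summable_Suc_iff)
    then show "summable (\<lambda>n. norm (exp \<alpha>) * exp (norm s * 2) * norm (p_poly (Suc n) \<alpha> * (1 / 2) ^ Suc n))"
      by (rule summable_mult)
    fix n and z :: complex assume "z \<in> sphere 0 2"
    then have z: "norm z = 2" by simp
    have "norm (exp (s * z)) \<le> exp (norm s * 2)"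
      using norm_exp[of "s * z"] by (simp add: norm_mult z)
    then have "norm (exp \<alpha>) * norm (p_poly (Suc n) \<alpha>) * (norm (exp (s * z)) / 2 ^ Suc n)
        \<le> norm (exp \<alpha>) * norm (p_poly (Suc n) \<alpha>) * (exp (norm s * 2) / 2 ^ Suc n)"
      by (intro mult_left_mono divide_right_mono) auto
    then show "norm (T n z) \<le> norm (exp \<alpha>) * exp (norm s * 2) * norm (p_poly (Suc n) \<alpha> * (1 / 2) ^ Suc n)"
      unfolding T_def
      by (simp add: norm_mult norm_divide norm_power z power_divide mult_ac del: p_poly.simps)
  qed
  have sum_T: "(\<Sum>n. T n z) = g z" if "z \<in> sphere 0 2" for z
  proof -
    have "(\<lambda>n. exp \<alpha> * ((- 1) ^ n * p_poly (Suc n) \<alpha>) / z ^ Suc n * exp (s * z)) sums (f_alpha \<alpha> z * exp (s * z))"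
      by (rule sums_mult2[OF f_alpha_laurent]) (use that in simp)
    then show ?thesis
      unfolding T_def g_def by (simp add: sums_iff mult_ac del: p_poly.simps)
  qed
  have "uniform_limit (sphere 0 2) (\<lambda>N z. \<Sum>n<N. T n z) g sequentially"
    by (rule iffD1[OF uniform_limit_cong' unif]) (rule refl, rule sum_T)
  then have "(\<lambda>N. contour_integral (circlepath 0 2) (\<lambda>z. \<Sum>n<N. T n z)) \<longlonglongrightarrow> contour_integral (circlepath 0 2) g"
    by (intro contour_integral_uniform_limit_circlepath(2) always_eventually allI contour_integrable_sum T) auto
  then have "(\<lambda>n. 2 * pi * \<i> * ((- 1) ^ n * (exp \<alpha> * p_poly (n + 1) \<alpha>) / fact n * s ^ n))
      sums contour_integral (circlepath 0 2) g"
    unfolding sums_def by (simp only: contour_integral_sum[OF finite_lessThan T(1)] T(2))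
  then have "(\<lambda>n. 2 * pi * \<i> * ((- 1) ^ n * (exp \<alpha> * p_poly (n + 1) \<alpha>) / fact n * s ^ n))
      sums (2 * pi * \<i> * (contour_integral (circlepath 0 2) g / (2 * pi * \<i>)))"
    by simp
  then have "(\<lambda>n. (- 1) ^ n * (exp \<alpha> * p_poly (n + 1) \<alpha>) / fact n * s ^ n)
      sums (contour_integral (circlepath 0 2) g / (2 * pi * \<i>))"
    by (rule iffD1[OF sums_mult_iff, rotated]) simp
  then have "contour_integral (circlepath 0 2) g / (2 * pi * \<i>) = egf (\<lambda>n. exp \<alpha> * p_poly (n + 1) \<alpha>) s"
    unfolding egf_def by (simp add: sums_iff)
  then show ?thesis
    unfolding phi_def g_def[symmetric]
    using rect_contour_shift[OF assms hol cont] rectpath_to_circlepath[OF assms hol] by simp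
qed

section \<open>Interlacing products have nonnegative partial fractions\<close>

definition geometric_fps :: "real \<Rightarrow> real fps" where
  "geometric_fps b = Abs_fps (\<lambda>n. b ^ n)"

lemma geometric_fps_nth [simp]: "fps_nth (geometric_fps b) n = b ^ n"
  by (simp add: geometric_fps_def)

lemma geometric_fps_inverse: "(1 - fps_const b * fps_X) * geometric_fps b = 1"
proof (rule fps_ext)
  fix n
  show "fps_nth ((1 - fps_const b * fps_X) * geometric_fps b) n = fps_nth 1 n"
    by (cases n) (simp_all add: left_diff_distrib mult.assoc)
qed

definition moebius_fps :: "real \<Rightarrow> real \<Rightarrow> real fps" where
  "moebius_fps a b = (1 - fps_const a * fps_X) * geometric_fps b"

lemma moebius_fps_eq: "moebius_fps a b = 1 + fps_const (b - a) * fps_X * geometric_fps b"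
proof -
  have "moebius_fps a b = (1 - fps_const b * fps_X) * geometric_fps b
      + fps_const (b - a) * fps_X * geometric_fps b"
    unfolding moebius_fps_def fps_const_sub[symmetric] by (simp only: algebra_simps)
  then show ?thesis unfolding geometric_fps_inverse .
qed

text \<open>
  The partial fraction decomposition of \<open>(1 - a X) / ((1 - b X) (1 - d X))\<close>. For \<open>d \<le> a \<le> b\<close> both
  coefficients are nonnegative, which is the reason behind the next lemma.
\<close>

lemma moebius_geometric:
  assumes "d \<noteq> b"
  shows "moebius_fps a b * geometric_fps d =
    fps_const ((b - a) / (b - d)) * geometric_fps b + fps_const ((a - d) / (b - d)) * geometric_fps d"
proof -
  have ring: "(B - D) * ((1 - A * x) * u * v) = (B - A) * u + (A - D) * v"
    if "(1 - B * x) * u = 1" "(1 - D * x) * v = 1" for A B D x u v :: "real fps"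
  proof -
    have "(B - A) * u + (A - D) * v = (B - A) * u * ((1 - D * x) * v) + (A - D) * v * ((1 - B * x) * u)"
      using that by simp
    also have "\<dots> = (B - D) * ((1 - A * x) * u * v)"
      by (simp only: algebra_simps)
    finally show ?thesis by simp
  qed
  have "fps_const (b - d) * (moebius_fps a b * geometric_fps d) =
      fps_const (b - a) * geometric_fps b + fps_const (a - d) * geometric_fps d"
    using ring[OF geometric_fps_inverse[of b] geometric_fps_inverse[of d], of "fps_const a"]
    unfolding moebius_fps_def by simp
  then have "fps_const (1 / (b - d)) * (fps_const (b - d) * (moebius_fps a b * geometric_fps d)) =
      fps_const (1 / (b - d)) * (fps_const (b - a) * geometric_fps b) +
      fps_const (1 / (b - d)) * (fps_const (a - d) * geometric_fps d)"
    by (simp only: distrib_left)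
  then show ?thesis
    using assms by (simp add: mult.assoc[symmetric] del: mult.assoc)
qed

text \<open>
  Multiplying by one more factor whose interval \<open>[a\<^sub>m, b\<^sub>m]\<close> lies to the right of all earlier poles
  \<open>b\<^sub>j\<close> keeps the old partial fraction coefficients nonnegative and creates a nonnegative new one.
\<close>

lemma interlacing_product:
  fixes a b :: "nat \<Rightarrow> real"
  assumes "\<And>j. j < m \<Longrightarrow> a j \<le> b j"
    and "\<And>i j. i < j \<Longrightarrow> j < m \<Longrightarrow> b i \<le> a j"
    and "\<And>i j. i < j \<Longrightarrow> j < m \<Longrightarrow> b i < b j"
  shows "\<exists>c. (\<forall>j<m. 0 \<le> c j) \<and>
    (\<Prod>j<m. moebius_fps (a j) (b j)) = 1 + fps_X * (\<Sum>j<m. fps_const (c j) * geometric_fps (b j))"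
  using assms
proof (induction m)
  case (Suc m)
  have "\<exists>c. (\<forall>j<m. 0 \<le> c j) \<and>
    (\<Prod>j<m. moebius_fps (a j) (b j)) = 1 + fps_X * (\<Sum>j<m. fps_const (c j) * geometric_fps (b j))"
    by (rule Suc.IH) (use Suc.prems in auto)
  then obtain c where c: "\<And>j. j < m \<Longrightarrow> 0 \<le> c j"
    and prod: "(\<Prod>j<m. moebius_fps (a j) (b j)) = 1 + fps_X * (\<Sum>j<m. fps_const (c j) * geometric_fps (b j))"
    by auto
  define A B where "A = a m" and "B = b m"
  have AB: "A \<le> B" and less: "\<And>j. j < m \<Longrightarrow> b j < B" "\<And>j. j < m \<Longrightarrow> b j \<le> A"
    using Suc.prems unfolding A_def B_def by auto
  define c' where "c' = (\<lambda>j. if j < m then c j * ((A - b j) / (B - b j))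
      else (B - A) + (\<Sum>j<m. c j * ((B - A) / (B - b j))))"
  have const_sum: "fps_const (\<Sum>j<m. f j) = (\<Sum>j<m. fps_const (f j))" for f :: "nat \<Rightarrow> real"
    by (rule fps_ext) (simp add: fps_sum_nth)
  have "(\<Sum>j<m. fps_const (c j) * geometric_fps (b j)) * moebius_fps A B =
      (\<Sum>j<m. fps_const (c j * ((B - A) / (B - b j))) * geometric_fps B
        + fps_const (c j * ((A - b j) / (B - b j))) * geometric_fps (b j))"
    unfolding sum_distrib_right
  proof (rule sum.cong[OF refl])
    fix j assume "j \<in> {..<m}"
    then have "b j \<noteq> B" using less(1)[of j] by auto
    have "fps_const (c j) * geometric_fps (b j) * moebius_fps A B =
        fps_const (c j) * (moebius_fps A B * geometric_fps (b j))" by (simp add: mult_ac)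
    then show "fps_const (c j) * geometric_fps (b j) * moebius_fps A B =
        fps_const (c j * ((B - A) / (B - b j))) * geometric_fps B
        + fps_const (c j * ((A - b j) / (B - b j))) * geometric_fps (b j)"
      unfolding moebius_geometric[OF \<open>b j \<noteq> B\<close>]
      by (simp only: distrib_left fps_const_mult[symmetric] mult.assoc)
  qed
  also have "\<dots> = fps_const (\<Sum>j<m. c j * ((B - A) / (B - b j))) * geometric_fps B
      + (\<Sum>j<m. fps_const (c' j) * geometric_fps (b j))"
    by (simp add: sum.distrib sum_distrib_right const_sum c'_def)
  finally have sum: "(\<Sum>j<m. fps_const (c j) * geometric_fps (b j)) * moebius_fps A B =
      fps_const (\<Sum>j<m. c j * ((B - A) / (B - b j))) * geometric_fps B
      + (\<Sum>j<m. fps_const (c' j) * geometric_fps (b j))" .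
  have c'm: "fps_const (c' m) = fps_const (B - A) + fps_const (\<Sum>j<m. c j * ((B - A) / (B - b j)))"
    by (simp add: c'_def)
  have "(\<Prod>j<Suc m. moebius_fps (a j) (b j)) = (\<Prod>j<m. moebius_fps (a j) (b j)) * moebius_fps A B"
    by (simp add: A_def B_def)
  also have "\<dots> = moebius_fps A B + fps_X * ((\<Sum>j<m. fps_const (c j) * geometric_fps (b j)) * moebius_fps A B)"
    unfolding prod by (simp add: algebra_simps)
  also have "\<dots> = 1 + fps_X * ((\<Sum>j<m. fps_const (c' j) * geometric_fps (b j))
      + fps_const (c' m) * geometric_fps B)"
    unfolding sum unfolding moebius_fps_eq c'm by (simp only: algebra_simps)
  finally have "(\<Prod>j<Suc m. moebius_fps (a j) (b j)) =
      1 + fps_X * (\<Sum>j<Suc m. fps_const (c' j) * geometric_fps (b j))"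
    by (simp add: B_def)
  moreover have "0 \<le> c' j" for j
  proof -
    have "0 \<le> (\<Sum>j<m. c j * ((B - A) / (B - b j)))"
      using AB less(1) c by (intro sum_nonneg mult_nonneg_nonneg divide_nonneg_nonneg) (auto simp: less_imp_le)
    then show ?thesis
      using AB less c[of j] by (auto simp: c'_def less_imp_le intro!: mult_nonneg_nonneg divide_nonneg_nonneg)
  qed
  ultimately show ?case by blast
qed simp

text \<open>
  The logarithmic derivative of \<open>(1 - a X) / (1 - b X)\<close>. It is additive over products, so a whole
  product is governed by the differences of power sums of the \<open>b\<^sub>j\<close> and the \<open>a\<^sub>j\<close>.
\<close>

lemma moebius_fps_deriv:
  "fps_deriv (moebius_fps a b) = Abs_fps (\<lambda>k. b ^ Suc k - a ^ Suc k) * moebius_fps a b"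
proof -
  define A B where "A = fps_const a" and "B = fps_const b"
  define u v where "u = geometric_fps a" and "v = geometric_fps b"
  have u: "(1 - A * fps_X) * u = 1" and v: "(1 - B * fps_X) * v = 1"
    unfolding A_def B_def u_def v_def by (rule geometric_fps_inverse)+
  have U: "Abs_fps (\<lambda>k. b ^ Suc k - a ^ Suc k) = B * v - A * u"
    by (rule fps_ext) (simp add: u_def v_def A_def B_def)
  have "0 = fps_deriv ((1 - B * fps_X) * v)" unfolding v by simp
  also have "\<dots> = (1 - B * fps_X) * fps_deriv v - B * v"
    by (simp add: B_def flip: fps_const_neg)
  finally have "v * ((1 - B * fps_X) * fps_deriv v) = v * (B * v)"
    by simp
  then have v': "fps_deriv v = v * (B * v)"
    using v by (metis mult.assoc mult.commute mult.left_neutral)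
  have "fps_deriv (moebius_fps a b) = (1 - A * fps_X) * fps_deriv v - A * v"
    unfolding moebius_fps_def v_def A_def by (simp flip: fps_const_neg)
  also have "\<dots> = B * v * ((1 - A * fps_X) * v) - A * v * ((1 - A * fps_X) * u)"
    unfolding v' u by (simp add: mult_ac)
  also have "\<dots> = (B * v - A * u) * ((1 - A * fps_X) * v)"
    by (simp add: algebra_simps)
  finally show ?thesis
    unfolding U moebius_fps_def A_def v_def .
qed

lemma prod_moebius_deriv:
  fixes a b :: "nat \<Rightarrow> real"
  shows "fps_deriv (\<Prod>j<m. moebius_fps (a j) (b j)) =
    Abs_fps (\<lambda>k. \<Sum>j<m. b j ^ Suc k - a j ^ Suc k) * (\<Prod>j<m. moebius_fps (a j) (b j))"
proof (induction m)
  case 0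
  have "Abs_fps (\<lambda>k. 0::real) = 0" by (rule fps_ext) simp
  then show ?case by simp
next
  case (Suc m)
  have "Abs_fps (\<lambda>k. \<Sum>j<Suc m. b j ^ Suc k - a j ^ Suc k) =
     Abs_fps (\<lambda>k. \<Sum>j<m. b j ^ Suc k - a j ^ Suc k) + Abs_fps (\<lambda>k. b m ^ Suc k - a m ^ Suc k)"
    by (rule fps_ext) simp
  then show ?case
    using Suc moebius_fps_deriv[of "a m" "b m"] by (simp add: algebra_simps)
qed

lemma interlacing_product_coefficients:
  fixes a b :: "nat \<Rightarrow> real"
  assumes "\<And>j. j < m \<Longrightarrow> a j \<le> b j"
    and "\<And>i j. i < j \<Longrightarrow> j < m \<Longrightarrow> b i \<le> a j"
    and "\<And>i j. i < j \<Longrightarrow> j < m \<Longrightarrow> b i < b j"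
  shows "\<exists>q c. q 0 = 1 \<and> (\<forall>n. q (Suc n) = (\<Sum>j<m. c j * b j ^ n)) \<and> (\<forall>j<m. 0 \<le> c j) \<and>
    (\<forall>n. real (Suc n) * q (Suc n) = (\<Sum>k\<le>n. (\<Sum>j<m. b j ^ Suc k - a j ^ Suc k) * q (n - k)))"
proof -
  obtain c where c: "\<forall>j<m. 0 \<le> c j" and
    prod: "(\<Prod>j<m. moebius_fps (a j) (b j)) = 1 + fps_X * (\<Sum>j<m. fps_const (c j) * geometric_fps (b j))"
    using interlacing_product[of m a b] assms by blast
  define q where "q = fps_nth (\<Prod>j<m. moebius_fps (a j) (b j))"
  have "q 0 = 1" "\<forall>n. q (Suc n) = (\<Sum>j<m. c j * b j ^ n)"
    unfolding q_def prod by (simp_all add: fps_sum_nth)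
  moreover have "real (Suc n) * q (Suc n) = (\<Sum>k\<le>n. (\<Sum>j<m. b j ^ Suc k - a j ^ Suc k) * q (n - k))" for n
    using arg_cong[OF prod_moebius_deriv, of "\<lambda>f. fps_nth f n"] unfolding q_def
    by (simp add: fps_mult_nth atLeast0AtMost add.commute)
  ultimately show ?thesis using c by blast
qed

section \<open>Discrete approximations of the moment sequence\<close>

text \<open>
  The right Riemann sums of \<open>t\<^sup>k\<close> on \<open>[0,1]\<close>.
\<close>

lemma tendsto_mean_of_powers:
  "(\<lambda>N. (\<Sum>j<Suc N. (real (Suc j) / real (Suc N)) ^ k) / real (Suc N)) \<longlonglongrightarrow> 1 / real (Suc k)"
proof (rule tendsto_sandwich[OF always_eventually always_eventually])
  define S where "S = (\<lambda>M. \<Sum>j<M. real (Suc j) ^ k)"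
  have tele: "(\<Sum>j<M. real (Suc j) ^ Suc k - real j ^ Suc k) = real M ^ Suc k" for M
    by (subst sum_lessThan_telescope) simp
  have diff: "real (Suc j) ^ Suc k - real j ^ Suc k = (\<Sum>p<Suc k. real (Suc j) ^ p * real j ^ (k - p))" for j
    by (subst diff_power_eq_sum) simp
  have up: "real (Suc j) ^ Suc k - real j ^ Suc k \<le> real (Suc k) * real (Suc j) ^ k" for j
  proof -
    have "real (Suc j) ^ Suc k - real j ^ Suc k \<le> (\<Sum>p<Suc k. real (Suc j) ^ p * real (Suc j) ^ (k - p))"
      unfolding diff by (intro sum_mono mult_left_mono power_mono) auto
    also have "\<dots> = (\<Sum>p<Suc k. real (Suc j) ^ k)"
      by (intro sum.cong refl) (simp del: of_nat_Suc flip: power_add)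
    finally show ?thesis by (simp only: sum_constant card_lessThan)
  qed
  have lo: "real (Suc k) * real j ^ k \<le> real (Suc j) ^ Suc k - real j ^ Suc k" for j
  proof -
    have "(\<Sum>p<Suc k. real j ^ p * real j ^ (k - p)) \<le> real (Suc j) ^ Suc k - real j ^ Suc k"
      unfolding diff by (intro sum_mono mult_right_mono power_mono) auto
    moreover have "(\<Sum>p<Suc k. real j ^ p * real j ^ (k - p)) = (\<Sum>p<Suc k. real j ^ k)"
      by (intro sum.cong refl) (simp flip: power_add)
    ultimately show ?thesis by (simp only: sum_constant card_lessThan)
  qed
  have 1: "real M ^ Suc k \<le> real (Suc k) * S M" for M
    unfolding tele[of M, symmetric] S_def sum_distrib_left by (intro sum_mono up)
  have 2: "real (Suc k) * S M \<le> real M ^ Suc k + real (Suc k) * real M ^ k" for M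
  proof -
    have "S M = (\<Sum>j<M. real j ^ k) + (\<Sum>j<M. real (Suc j) ^ k - real j ^ k)"
      unfolding S_def by (simp flip: sum.distrib)
    also have "\<dots> \<le> (\<Sum>j<M. real j ^ k) + real M ^ k"
      by (subst sum_lessThan_telescope) simp
    finally have "real (Suc k) * S M \<le> real (Suc k) * (\<Sum>j<M. real j ^ k) + real (Suc k) * real M ^ k"
      by (metis distrib_left mult_left_mono of_nat_0_le_iff)
    moreover have "real (Suc k) * (\<Sum>j<M. real j ^ k) \<le> real M ^ Suc k"
      unfolding tele[of M, symmetric] sum_distrib_left by (intro sum_mono lo)
    ultimately show ?thesis by linarith
  qed
  have mean: "(\<Sum>j<M. (real (Suc j) / real M) ^ k) / real M = S M / real M ^ Suc k" for M
    unfolding S_def by (simp add: power_divide sum_divide_distrib mult.commute)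
  show "\<forall>N. 1 / real (Suc k) \<le> (\<Sum>j<Suc N. (real (Suc j) / real (Suc N)) ^ k) / real (Suc N)"
  proof
    fix N
    show "1 / real (Suc k) \<le> (\<Sum>j<Suc N. (real (Suc j) / real (Suc N)) ^ k) / real (Suc N)"
      unfolding mean using 1[of "Suc N"]
      by (simp add: field_simps del: of_nat_Suc power_Suc)
  qed
  show "\<forall>N. (\<Sum>j<Suc N. (real (Suc j) / real (Suc N)) ^ k) / real (Suc N) \<le> 1 / real (Suc k) + 1 / real (Suc N)"
  proof
    fix N
    have eq1: "1 / real (Suc k) + 1 / real (Suc N) =
       (real (Suc N) ^ Suc k + real (Suc k) * real (Suc N) ^ k) / (real (Suc k) * real (Suc N) ^ Suc k)"
      by (simp add: divide_simps distrib_right del: of_nat_Suc)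
    have eq2: "S (Suc N) / real (Suc N) ^ Suc k =
       (real (Suc k) * S (Suc N)) / (real (Suc k) * real (Suc N) ^ Suc k)"
      by (simp del: of_nat_Suc)
    show "(\<Sum>j<Suc N. (real (Suc j) / real (Suc N)) ^ k) / real (Suc N) \<le> 1 / real (Suc k) + 1 / real (Suc N)"
      unfolding mean eq1 eq2 by (intro divide_right_mono 2) simp
  qed
  show "(\<lambda>N. 1 / real (Suc k) + 1 / real (Suc N)) \<longlonglongrightarrow> 1 / real (Suc k)"
    using tendsto_add[OF tendsto_const[of "1 / real (Suc k)"] lim_inverse_n'[THEN LIMSEQ_Suc]] by simp
qed simp

lemma p_poly_of_real: "p_poly n (of_real x) = of_real (Re (p_poly n (of_real x)))"
proof -
  have "p_poly n (of_real x) \<in> \<real>"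
  proof (induction n rule: less_induct)
    case (less n)
    then show ?case
      by (cases n) (auto intro!: Reals_mult Reals_divide sum_in_Reals Reals_add)
  qed
  then show ?thesis by (simp add: of_real_Re)
qed

lemma p_poly_real_recurrence:
  fixes x :: real
  defines "p \<equiv> (\<lambda>n. Re (p_poly n (of_real x)))"
  shows "real (Suc n) * p (Suc n) = (\<Sum>k\<le>n. x * real (Suc k) / real (Suc (Suc k)) * p (n - k))"
proof -
  have P: "p_poly m (of_real x) = of_real (p m)" for m
    unfolding p_def by (rule p_poly_of_real)
  have "of_real (real (Suc n) * p (Suc n)) =
      complex_of_real (\<Sum>k\<le>n. x * real (Suc k) / real (Suc (Suc k)) * p (n - k))"
    using p_poly_recurrence[of n "of_real x"] unfolding P
    by (simp add: sum_distrib_left mult_ac add_ac)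
  then show ?thesis by (simp only: of_real_eq_iff)
qed

text \<open>
  The intervals \<open>[b\<^sub>j (1 - x/M), b\<^sub>j]\<close> with \<open>b\<^sub>j = j/M\<close> and \<open>M = N + 1\<close> fill the fraction \<open>x b\<^sub>j\<close> of the cell
  that ends at \<open>b\<^sub>j\<close>, so they approximate the density \<open>x t\<close>; the limit is \<open>\<integral>\<^sub>0\<^sup>1 x t k t\<^sup>k\<^sup>-\<^sup>1 dt\<close>. The proportional
  form of the intervals lets the factor \<open>1 - (1 - x/M)\<^sup>k\<close> come out of the sum.
\<close>

lemma tendsto_power_sums:
  "(\<lambda>N. \<Sum>j<Suc N. (real (Suc j) / real (Suc N)) ^ k - (real (Suc j) / real (Suc N) * (1 - x / real (Suc N))) ^ k)
     \<longlonglongrightarrow> x * real k / real (Suc k)"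
proof -
  have "(\<lambda>N. x / real (Suc N)) \<longlonglongrightarrow> 0"
    using tendsto_mult[OF tendsto_const[of x] LIMSEQ_inverse_real_of_nat] by (simp add: divide_inverse)
  then have "(\<lambda>N. x * (\<Sum>i<k. (1 - x / real (Suc N)) ^ i)) \<longlonglongrightarrow> x * (\<Sum>i<k. (1 - 0) ^ i)"
    by (intro tendsto_intros)
  from tendsto_mult[OF this tendsto_mean_of_powers[of k]]
  have "(\<lambda>N. x * (\<Sum>i<k. (1 - x / real (Suc N)) ^ i) *
      ((\<Sum>j<Suc N. (real (Suc j) / real (Suc N)) ^ k) / real (Suc N))) \<longlonglongrightarrow> x * real k / real (Suc k)"
    by simp
  moreover have "x * (\<Sum>i<k. (1 - x / real (Suc N)) ^ i) * ((\<Sum>j<Suc N. (real (Suc j) / real (Suc N)) ^ k) / real (Suc N))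
     = (\<Sum>j<Suc N. (real (Suc j) / real (Suc N)) ^ k - (real (Suc j) / real (Suc N) * (1 - x / real (Suc N))) ^ k)" for N
  proof -
    have "1 - (1 - x / real (Suc N)) ^ k = x / real (Suc N) * (\<Sum>i<k. (1 - x / real (Suc N)) ^ i)"
      by (subst one_diff_power_eq) simp
    then have e1: "x * (\<Sum>i<k. (1 - x / real (Suc N)) ^ i) / real (Suc N) = 1 - (1 - x / real (Suc N)) ^ k"
      by simp
    have e2: "(\<Sum>j<Suc N. (real (Suc j) / real (Suc N)) ^ k - (real (Suc j) / real (Suc N) * (1 - x / real (Suc N))) ^ k)
      = (1 - (1 - x / real (Suc N)) ^ k) * (\<Sum>j<Suc N. (real (Suc j) / real (Suc N)) ^ k)"
      unfolding power_mult_distrib sum_distrib_left by (intro sum.cong refl) (simp add: left_diff_distrib)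
    show ?thesis unfolding e2 e1[symmetric] by (simp only: times_divide_eq_left times_divide_eq_right)
  qed
  ultimately show ?thesis by simp
qed

text \<open>
  The coefficients of the interlacing products satisfy a recurrence with the same shape as that of
  the \<open>p\<^sub>n\<close>, whose weights converge to those of the \<open>p\<^sub>n\<close>. The condition \<open>x \<le> 1\<close> is exactly what keeps
  the intervals inside their cells, that is, interlacing.
\<close>

lemma finite_moments_approximate_p_poly:
  assumes "0 \<le> x" "x \<le> 1"
  shows "\<exists>c. (\<forall>N. \<forall>j<Suc N. 0 \<le> c N j) \<and>
    (\<forall>n. (\<lambda>N. \<Sum>j<Suc N. c N j * (real (Suc j) / real (Suc N)) ^ n) \<longlonglongrightarrow> Re (p_poly (Suc n) (of_real x)))"
proof -
  define b where "b = (\<lambda>N j. real (Suc j) / real (Suc N))"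
  define a where "a = (\<lambda>N j. b N j * (1 - x / real (Suc N)))"
  define s where "s = (\<lambda>N k. \<Sum>j<Suc N. b N j ^ Suc k - a N j ^ Suc k)"
  \<comment> \<open>Abbreviating the properties of the pair \<open>q\<close>, \<open>c\<close> allows choosing both as functions of \<open>N\<close>.\<close>
  define P where "P = (\<lambda>N q c. q 0 = (1::real) \<and>
    (\<forall>n. q (Suc n) = (\<Sum>j<Suc N. c j * b N j ^ n)) \<and> (\<forall>j<Suc N. 0 \<le> c j) \<and>
    (\<forall>n. real (Suc n) * q (Suc n) = (\<Sum>k\<le>n. s N k * q (n - k))))"
  have "\<exists>q c. P N q c" for N
    unfolding P_def s_def
  proof (rule interlacing_product_coefficients)
    show "a N j \<le> b N j" for j
      using assms mult_left_mono[of "1 - x / real (Suc N)" 1 "b N j"] by (simp add: a_def b_def)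
    show "b N i < b N j" if "i < j" for i j
      using that by (simp add: b_def divide_strict_right_mono)
    show "b N i \<le> a N j" if "i < j" "j < Suc N" for i j
    proof -
      have "x * real (Suc j) \<le> 1 * real (Suc N)"
        using that assms by (intro mult_mono) auto
      then have "real (Suc N) * real (Suc i) + x * real (Suc j) \<le> real (Suc N) * real (Suc i) + real (Suc N)"
        by simp
      also have "\<dots> = real (Suc N) * real (Suc (Suc i))" by (simp add: algebra_simps)
      also have "\<dots> \<le> real (Suc N) * real (Suc j)"
        using that by (intro mult_left_mono) auto
      finally have "real (Suc N) * real (Suc i) \<le> real (Suc j) * (real (Suc N) - x)"
        unfolding right_diff_distrib by (simp only: mult.commute)
      then show ?thesis
        unfolding a_def b_def by (simp add: divide_simps mult_ac del: of_nat_Suc)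
    qed
  qed
  then obtain q c where "\<And>N. P N (q N) (c N)" by metis
  then have q0: "\<And>N. q N 0 = 1"
    and qc: "\<And>N n. q N (Suc n) = (\<Sum>j<Suc N. c N j * b N j ^ n)"
    and c: "\<And>N j. j < Suc N \<Longrightarrow> 0 \<le> c N j"
    and q: "\<And>N n. real (Suc n) * q N (Suc n) = (\<Sum>k\<le>n. s N k * q N (n - k))"
    unfolding P_def by blast+
  have s: "(\<lambda>N. s N k) \<longlonglongrightarrow> x * real (Suc k) / real (Suc (Suc k))" for k
    unfolding s_def a_def b_def by (rule tendsto_power_sums)
  have "(\<lambda>N. q N n) \<longlonglongrightarrow> Re (p_poly n (of_real x))" for n
  proof (induction n rule: less_induct)
    case (less n)
    show ?case
    proof (cases n)
      case (Suc m)
      have "(\<lambda>N. \<Sum>k\<le>m. s N k * q N (m - k)) \<longlonglongrightarrow>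
          (\<Sum>k\<le>m. x * real (Suc k) / real (Suc (Suc k)) * Re (p_poly (m - k) (of_real x)))"
        using Suc by (intro tendsto_sum tendsto_mult s less) auto
      then have "(\<lambda>N. real (Suc m) * q N (Suc m)) \<longlonglongrightarrow> real (Suc m) * Re (p_poly (Suc m) (of_real x))"
        unfolding q p_poly_real_recurrence .
      then have "(\<lambda>N. real (Suc m) * q N (Suc m) / real (Suc m)) \<longlonglongrightarrow>
          real (Suc m) * Re (p_poly (Suc m) (of_real x)) / real (Suc m)"
        by (rule tendsto_divide[OF _ tendsto_const]) simp
      then show ?thesis unfolding Suc by (simp del: of_nat_Suc p_poly.simps)
    qed (simp add: q0)
  qed
  then have "(\<lambda>N. q N (Suc n)) \<longlonglongrightarrow> Re (p_poly (Suc n) (of_real x))" for n .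
  then have "\<forall>n. (\<lambda>N. \<Sum>j<Suc N. c N j * (real (Suc j) / real (Suc N)) ^ n) \<longlonglongrightarrow> Re (p_poly (Suc n) (of_real x))"
    unfolding qc b_def by (rule allI)
  moreover have "\<forall>N. \<forall>j<Suc N. 0 \<le> c N j" using c by simp
  ultimately show ?thesis by (intro exI[of _ c] conjI)
qed

section \<open>Limits of discrete moment sequences on the unit interval\<close>

lemma weak_limit_on_unit_interval:
  fixes \<mu> :: "nat \<Rightarrow> real measure"
  assumes \<mu>: "\<And>k. real_distribution (\<mu> k)" and supp: "\<And>k. measure (\<mu> k) {0..1} = 1"
  shows "\<exists>r M. strict_mono (r :: nat \<Rightarrow> nat) \<and> real_distribution M \<and> weak_conv_m (\<mu> \<circ> r) M"
proof -
  have "1 - e < measure (\<mu> k) {-1<..1}" if "e > 0" for e k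
  proof -
    interpret real_distribution "\<mu> k" by (rule \<mu>)
    have "measure (\<mu> k) {0..1} \<le> measure (\<mu> k) {-1<..1}"
      by (rule finite_measure_mono) auto
    then show ?thesis using supp[of k] that by simp
  qed
  then have "tight \<mu>"
    unfolding tight_def using \<mu> by (intro conjI allI impI exI[of _ "-1"] exI[of _ 1]) auto
  from tight_imp_convergent_subsubsequence[OF this strict_mono_id] show ?thesis
    by (auto simp: o_def)
qed

lemma finite_discrete_measure:
  fixes w y :: "nat \<Rightarrow> real"
  assumes w: "\<And>j. j < n \<Longrightarrow> 0 \<le> w j" "(\<Sum>j<n. w j) = 1" and y: "\<And>j. j < n \<Longrightarrow> y j \<in> {0..1}"
  shows "\<exists>\<mu>. real_distribution \<mu> \<and> measure \<mu> {0..1} = 1 \<and>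
    (\<forall>f \<in> borel_measurable borel. integral\<^sup>L \<mu> f = (\<Sum>j<n. w j * f (y j)))"
proof -
  define D where "D = point_measure {..<n} (\<lambda>j. ennreal (w j))"
  define \<mu> where "\<mu> = distr D borel y"
  have [measurable]: "y \<in> borel_measurable D"
    unfolding D_def by (simp add: measurable_def space_point_measure sets_point_measure) 
  have "emeasure D (space D) = (\<Sum>j<n. ennreal (w j))"
    unfolding D_def by (subst emeasure_point_measure_finite) (auto simp: space_point_measure)
  also have "\<dots> = 1"
    using w by (subst sum_ennreal) auto
  finally interpret D: prob_space D by (rule prob_spaceI)
  have "real_distribution \<mu>" unfolding \<mu>_def by (rule D.real_distribution_distr) simp
  moreover have int: "integral\<^sup>L \<mu> f = (\<Sum>j<n. w j * f (y j))" if "f \<in> borel_measurable borel" for f :: "real \<Rightarrow> real"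
    unfolding \<mu>_def using that
    by (subst integral_distr, simp, simp) (unfold D_def, subst lebesgue_integral_point_measure_finite, use w in auto)
  moreover have "measure \<mu> {0..1} = 1"
  proof -
    have "y -` {0..1} \<inter> space D = space D"
      using y by (auto simp: D_def space_point_measure)
    then show ?thesis
      unfolding \<mu>_def by (subst measure_distr) (auto simp: D.prob_space)
  qed
  ultimately show ?thesis by blast
qed

text \<open>
  Unless the limit is the zero sequence, the discrete measures can be normalized to probability
  measures on \<open>[0,1]\<close>; a weak limit of a subsequence, rescaled, has the required moments.
\<close>

lemma hausdorff_moment_seq_limit:
  fixes c y :: "nat \<Rightarrow> nat \<Rightarrow> real"
  assumes c: "\<And>N j. j < d N \<Longrightarrow> 0 \<le> c N j" and y: "\<And>N j. j < d N \<Longrightarrow> y N j \<in> {0..1}"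
    and lim: "\<And>n. (\<lambda>N. \<Sum>j<d N. c N j * y N j ^ n) \<longlonglongrightarrow> m n"
  shows "hausdorff_moment_seq (\<lambda>n. of_real (m n))"
proof (cases "m 0 > 0")
  case False
  have "\<bar>m n\<bar> \<le> m 0" for n
  proof (rule LIMSEQ_le)
    show "(\<lambda>N. \<bar>\<Sum>j<d N. c N j * y N j ^ n\<bar>) \<longlonglongrightarrow> \<bar>m n\<bar>"
      by (rule tendsto_rabs[OF lim])
    show "(\<lambda>N. \<Sum>j<d N. c N j * y N j ^ 0) \<longlonglongrightarrow> m 0" by (rule lim)
    have "\<bar>\<Sum>j<d N. c N j * y N j ^ n\<bar> \<le> (\<Sum>j<d N. c N j * y N j ^ 0)" for N
    proof (rule order_trans[OF sum_abs sum_mono])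
      fix j assume "j \<in> {..<d N}"
      then show "\<bar>c N j * y N j ^ n\<bar> \<le> c N j * y N j ^ 0"
        using c[of j N] y[of j N] by (simp add: abs_mult power_le_one mult_left_le)
    qed
    then show "\<exists>N. \<forall>k\<ge>N. \<bar>\<Sum>j<d k. c k j * y k j ^ n\<bar> \<le> (\<Sum>j<d k. c k j * y k j ^ 0)" by blast
  qed
  then have "m n = 0" for n using False by (metis abs_le_zero_iff not_le order_trans)
  then have "represents_moments {0..1} (null_measure (restrict_space borel {0..1})) (\<lambda>n. of_real (m n))"
    unfolding represents_moments_def by (auto intro!: measurable_restrict_space1)
  then show ?thesis unfolding hausdorff_moment_seq_def by blast
next
  case True
  define t where "t = (\<lambda>N. \<Sum>j<d N. c N j * y N j ^ 0)"
  have t: "t \<longlonglongrightarrow> m 0" unfolding t_def by (rule lim)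
  then have "eventually (\<lambda>N. t N > 0) sequentially"
    using True by (rule order_tendstoD(1))
  then obtain N0 where N0: "\<And>N. N \<ge> N0 \<Longrightarrow> t N > 0" by (auto simp: eventually_sequentially)
  \<comment> \<open>From the index \<open>N0\<close> on the total mass \<open>t\<close> is positive.\<close>
  define K where "K = (\<lambda>k. k + N0)"
  have "\<exists>\<mu>. real_distribution \<mu> \<and> measure \<mu> {0..1} = 1 \<and>
    (\<forall>f \<in> borel_measurable borel. integral\<^sup>L \<mu> f = (\<Sum>j<d (K k). (c (K k) j / t (K k)) * f (y (K k) j)))" for k
  proof (rule finite_discrete_measure)
    have "t (K k) > 0" using N0 by (simp add: K_def)
    then show "0 \<le> c (K k) j / t (K k)" if "j < d (K k)" for j using c[OF that] by simp
    show "(\<Sum>j<d (K k). c (K k) j / t (K k)) = 1"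
      using \<open>t (K k) > 0\<close> by (simp add: t_def flip: sum_divide_distrib)
  qed (rule y)
  then obtain \<mu> where \<mu>: "\<And>k. real_distribution (\<mu> k)" "\<And>k. measure (\<mu> k) {0..1} = 1"
    and int: "\<And>k f. f \<in> borel_measurable borel \<Longrightarrow>
        integral\<^sup>L (\<mu> k) f = (\<Sum>j<d (K k). (c (K k) j / t (K k)) * f (y (K k) j))"
    by metis
  obtain r M where r: "strict_mono r" and M: "real_distribution M" and conv: "weak_conv_m (\<mu> \<circ> r) M"
    using weak_limit_on_unit_interval[of \<mu>] \<mu> by blast
  interpret M: real_distribution M by (rule M)
  \<comment> \<open>Clamping to \<open>[0,1]\<close> makes the powers bounded and continuous on the line, does not change the
    moments of the discrete measures, and pushes the limit measure forward to \<open>[0,1]\<close>.\<close>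
  define clamp where "clamp = (\<lambda>x::real. max 0 (min 1 x))"
  have clamp: "clamp x \<in> {0..1}" "x \<in> {0..1} \<Longrightarrow> clamp x = x" for x
    unfolding clamp_def by auto
  have [measurable]: "clamp \<in> borel_measurable borel" unfolding clamp_def by simp
  have moments: "m 0 * (\<integral>x. clamp x ^ n \<partial>M) = m n" for n
  proof -
    have "(\<lambda>k. integral\<^sup>L ((\<mu> \<circ> r) k) (\<lambda>x. clamp x ^ n)) \<longlonglongrightarrow> (\<integral>x. clamp x ^ n \<partial>M)"
    proof (rule weak_conv_imp_integral_bdd_continuous_conv[OF _ M conv])
      show "real_distribution ((\<mu> \<circ> r) k)" for k using \<mu> by simp
      show "isCont (\<lambda>x. clamp x ^ n) x" for x unfolding clamp_def by (intro continuous_intros)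
      show "norm (clamp x ^ n) \<le> 1" for x using clamp(1)[of x] by (simp add: power_le_one)
    qed
    moreover have "integral\<^sup>L (\<mu> k) (\<lambda>x. clamp x ^ n) = (\<Sum>j<d (K k). c (K k) j * y (K k) j ^ n) / t (K k)" for k
      by (subst int, simp) (auto simp: sum_divide_distrib clamp(2)[OF y] intro!: sum.cong)
    ultimately have "(\<lambda>k. (\<Sum>j<d (K (r k)). c (K (r k)) j * y (K (r k)) j ^ n) / t (K (r k)))
        \<longlonglongrightarrow> (\<integral>x. clamp x ^ n \<partial>M)"
      by (simp add: o_def)
    moreover have "filterlim (\<lambda>k. K (r k)) sequentially sequentially"
      unfolding K_def using r by (intro filterlim_subseq) (simp add: strict_mono_def)
    then have "(\<lambda>k. (\<Sum>j<d (K (r k)). c (K (r k)) j * y (K (r k)) j ^ n) / t (K (r k))) \<longlonglongrightarrow> m n / m 0"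
      using True by (intro tendsto_divide filterlim_compose[OF lim] filterlim_compose[OF t]) auto
    ultimately have "(\<integral>x. clamp x ^ n \<partial>M) = m n / m 0" by (rule LIMSEQ_unique)
    then show ?thesis using True by simp
  qed
  define \<sigma>' where "\<sigma>' = distr M (restrict_space borel {0..1}) clamp"
  define \<sigma> where "\<sigma> = density \<sigma>' (\<lambda>_. ennreal (m 0))"
  have [measurable]: "clamp \<in> measurable M (restrict_space borel {0..1})"
    by (rule measurable_restrict_space2) (use clamp in auto)
  have pow [measurable]: "(\<lambda>x::real. x ^ n) \<in> borel_measurable (restrict_space borel {0..1})" for n
    by (rule measurable_restrict_space1) simp
  have "integrable M (\<lambda>x. clamp x ^ n)" for n
    by (rule M.integrable_const_bound[of _ 1]) (use clamp in \<open>auto simp: power_le_one\<close>)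
  then have int': "integrable \<sigma>' (\<lambda>x. x ^ n)" for n
    unfolding \<sigma>'_def by (subst integrable_distr_eq) auto
  have "represents_moments {0..1} \<sigma> (\<lambda>n. of_real (m n))"
    unfolding represents_moments_def
  proof (intro conjI allI)
    show "sets \<sigma> = sets (restrict_space borel {0..1})" by (simp add: \<sigma>_def \<sigma>'_def)
    fix n
    have [measurable]: "(\<lambda>x::real. x ^ n) \<in> borel_measurable \<sigma>'" by (simp add: \<sigma>'_def)
    show "integrable \<sigma> (\<lambda>x. x ^ n)"
      unfolding \<sigma>_def using True int' by (subst integrable_density) auto
    have "(\<integral>x. x ^ n \<partial>\<sigma>) = m 0 * (\<integral>x. x ^ n \<partial>\<sigma>')"
      unfolding \<sigma>_def using True by (subst integral_density) auto
    also have "\<dots> = m n"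
      unfolding \<sigma>'_def by (subst integral_distr) (auto simp: moments)
    finally show "complex_of_real (m n) = complex_of_real (\<integral>x. x ^ n \<partial>\<sigma>)" by simp
  qed
  then show ?thesis unfolding hausdorff_moment_seq_def by blast
qed

lemma hausdorff_p_poly:
  assumes "0 \<le> x" "x \<le> 1"
  shows "hausdorff_moment_seq (\<lambda>n. p_poly (n + 1) (of_real x))"
proof -
  obtain c where c: "\<And>N j. j < Suc N \<Longrightarrow> 0 \<le> c N j"
    "\<And>n. (\<lambda>N. \<Sum>j<Suc N. c N j * (real (Suc j) / real (Suc N)) ^ n) \<longlonglongrightarrow> Re (p_poly (Suc n) (of_real x))"
    using finite_moments_approximate_p_poly[OF assms] by blast
  have "hausdorff_moment_seq (\<lambda>n. of_real (Re (p_poly (Suc n) (of_real x))))"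
    by (rule hausdorff_moment_seq_limit[of Suc c "\<lambda>N j. real (Suc j) / real (Suc N)"])
       (use c in \<open>auto simp: divide_simps\<close>)
  then show ?thesis
    unfolding p_poly_of_real[symmetric] by (simp del: p_poly.simps)
qed

section \<open>Necessity of the parameter range\<close>

text \<open>
  For \<open>0 < w < 1\<close> a bound \<open>K\<close> on the coefficients gives \<open>G(w) \<le> K / (1 - w)\<close>, whereas
  \<open>G(w) \<ge> exp (- x) (1 - w)\<^sup>-\<^sup>x\<close>. For \<open>x > 1\<close> these are incompatible when \<open>w\<close> is close to 1.
\<close>

lemma bounded_p_poly_imp_le_1:
  assumes K: "\<And>n. norm (p_poly n (of_real x)) \<le> K" and "x \<ge> 0"
  shows "x \<le> 1"
proof (rule ccontr)
  assume "\<not> x \<le> 1"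
  then have x: "x > 1" by simp
  have "K \<ge> 1" using K[of 0] by simp
  \<comment> \<open>With \<open>1 - w = exp (- L)\<close> the two bounds on \<open>G(w)\<close> give \<open>(x - 1) L \<le> ln K + x\<close>; this \<open>L\<close> violates that by 1.\<close>
  define L where "L = (ln K + x + 1) / (x - 1)"
  have L: "L > 0" using \<open>K \<ge> 1\<close> x by (simp add: L_def add_nonneg_pos)
  define w where "w = 1 - exp (- L)"
  have w: "0 < w" "w < 1" using L by (simp_all add: w_def)
  have "log_series (of_real w) = of_real (L / w)"
  proof -
    have "log_series (of_real w) = - Ln (of_real (1 - w)) / of_real w"
      using log_series_eq_Ln[of "of_real w"] w by simp
    also have "Ln (of_real (1 - w)) = of_real (ln (1 - w))"
      using w by (intro Ln_of_real) simp
    also have "ln (1 - w) = - L" by (simp add: w_def)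
    finally show ?thesis by simp
  qed
  then have "(\<lambda>n. p_poly n (of_real x) * of_real w ^ n) sums exp (of_real (x * (L / w - 1)))"
    using p_poly_generating_function[of "of_real w" "of_real x"] w by simp
  moreover have "summable (\<lambda>n. norm (p_poly n (of_real x) * of_real w ^ n))"
    by (rule summable_norm_p_poly) (use w in simp)
  ultimately have "norm (exp (complex_of_real (x * (L / w - 1)))) \<le> (\<Sum>n. norm (p_poly n (of_real x) * of_real w ^ n))"
    using summable_norm by (metis sums_unique)
  also have "\<dots> \<le> (\<Sum>n. K * w ^ n)"
  proof (rule suminf_le)
    show "norm (p_poly n (of_real x) * of_real w ^ n) \<le> K * w ^ n" for n
      using mult_right_mono[OF K[of n], of "w ^ n"] w by (simp add: norm_mult norm_power)
    show "summable (\<lambda>n. norm (p_poly n (of_real x) * of_real w ^ n))" by fact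
    show "summable (\<lambda>n. K * w ^ n)" using w by (intro summable_mult summable_geometric) simp
  qed
  also have "\<dots> = K / (1 - w)"
    using w by (simp add: suminf_mult suminf_geometric summable_geometric)
  also have "K / (1 - w) = K * exp L"
    by (simp add: w_def exp_minus divide_inverse)
  finally have "exp (x * (L / w - 1)) \<le> K * exp L"
    by (simp only: norm_exp_eq_Re Re_complex_of_real)
  moreover have "L \<le> L / w" using L w by (simp add: field_simps)
  then have "x * (L - 1) \<le> x * (L / w - 1)" using x by (intro mult_left_mono) auto
  ultimately have "exp (x * (L - 1)) \<le> exp (ln K + L)"
    using \<open>K \<ge> 1\<close> by (simp add: exp_add order_trans[rotated])
  then have "x * (L - 1) \<le> ln K + L" by (simp only: exp_le_cancel_iff)
  moreover have "(x - 1) * L = ln K + x + 1" using x by (simp add: L_def)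
  ultimately show False by (simp add: algebra_simps)
qed

text \<open>
  The ratios of consecutive terms increase. If one of them exceeded 1, the sequence would grow at
  least geometrically.
\<close>

lemma log_convex_subexponential_imp_decreasing:
  fixes a :: "nat \<Rightarrow> real"
  assumes pos: "\<And>n. a n > 0" and log_convex: "\<And>n. (a (Suc n))\<^sup>2 \<le> a n * a (Suc (Suc n))"
    and subexp: "\<And>w. 0 < w \<Longrightarrow> w < 1 \<Longrightarrow> (\<lambda>n. a n * w ^ n) \<longlonglongrightarrow> 0"
  shows "a (Suc n) \<le> a n"
proof (rule ccontr)
  assume "\<not> a (Suc n) \<le> a n"
  define q where "q = a (Suc n) / a n"
  have q: "q > 1" using \<open>\<not> a (Suc n) \<le> a n\<close> pos[of n] by (simp add: q_def)
  have ratio: "q * a (n + k) \<le> a (n + Suc k)" for k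
  proof (induction k)
    case 0
    show ?case using pos[of n] by (simp add: q_def)
  next
    case (Suc k)
    have "a (n + k) * (q * a (n + Suc k)) \<le> a (n + Suc k) * a (n + Suc k)"
      using mult_right_mono[OF Suc, of "a (n + Suc k)"] pos[of "n + Suc k"] by (simp add: mult_ac)
    also have "\<dots> \<le> a (n + k) * a (n + Suc (Suc k))"
      using log_convex[of "n + k"] by (simp add: power2_eq_square)
    finally show ?case using pos[of "n + k"] by simp
  qed
  have growth: "q ^ k * a n \<le> a (n + k)" for k
  proof (induction k)
    case (Suc k)
    have "q ^ Suc k * a n \<le> q * a (n + k)" using Suc q by simp
    then show ?case using ratio[of k] by simp
  qed simp
  have "a n * (1 / q) ^ n \<le> a (k + n) * (1 / q) ^ (k + n)" for k
  proof -
    have "a n = q ^ k * a n * (1 / q) ^ k" using q by (simp add: power_divide)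
    also have "\<dots> \<le> a (n + k) * (1 / q) ^ k"
      using growth[of k] q by (intro mult_right_mono) auto
    finally have "a n * (1 / q) ^ n \<le> a (n + k) * (1 / q) ^ k * (1 / q) ^ n"
      using q by (intro mult_right_mono) auto
    then show ?thesis by (simp add: power_add add.commute mult.assoc)
  qed
  moreover have "(\<lambda>k. a (k + n) * (1 / q) ^ (k + n)) \<longlonglongrightarrow> 0"
    using q by (intro LIMSEQ_ignore_initial_segment[where f = "\<lambda>m. a m * (1 / q) ^ m"] subexp) auto
  ultimately have "a n * (1 / q) ^ n \<le> 0"
    by (intro LIMSEQ_le_const) auto
  moreover have "a n * (1 / q) ^ n > 0" using pos[of n] q by simp
  ultimately show False by linarith
qed

text \<open>
  The form is smallest at \<open>l = B / A\<close>.
\<close>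

lemma nonneg_quadratic_imp_log_convex:
  fixes A B C :: real
  assumes "\<And>l. 0 \<le> C - 2 * l * B + l\<^sup>2 * A" and "A > 0"
  shows "B\<^sup>2 \<le> A * C"
proof -
  have "0 \<le> A * (C - 2 * (B / A) * B + (B / A)\<^sup>2 * A)"
    using assms(1)[of "B / A"] assms(2) by simp
  also have "\<dots> = A * C - B\<^sup>2"
    using assms(2) by (simp add: field_simps power2_eq_square)
  finally show ?thesis by simp
qed

text \<open>
  The common core of the two necessity proofs. Since \<open>p\<^sub>1 = \<alpha>/2\<close> and \<open>p\<^sub>2 = (\<alpha>/2) (\<alpha>/4 + 2/3)\<close>, the quotient
  \<open>a\<^sub>1 / a\<^sub>0\<close> is real only if \<open>\<alpha>\<close> is; positivity of \<open>C\<close> can therefore be restricted to real \<open>\<alpha>\<close>, which suits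
  \<open>C = exp \<alpha>\<close>.
\<close>

lemma log_convex_p_poly_imp_unit_interval:
  assumes a: "\<And>n. C * p_poly (Suc n) \<alpha> = of_real (a n)"
    and C: "C \<noteq> 0" "\<alpha> \<in> \<real> \<Longrightarrow> C \<in> \<real> \<and> 0 < Re C"
    and nonneg: "\<And>n. 0 \<le> a n"
    and quad: "\<And>n l. 0 \<le> a (Suc (Suc n)) - 2 * l * a (Suc n) + l\<^sup>2 * a n"
  shows "\<alpha> \<in> \<real> \<and> 0 \<le> Re \<alpha> \<and> Re \<alpha> \<le> 1"
proof (cases "\<alpha> = 0")
  case False
  have p1: "C * (\<alpha> / 2) = of_real (a 0)" using a[of 0] by simp
  \<comment> \<open>Reality of \<open>\<alpha>\<close> is read off from the quotient of the first two terms.\<close>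
  have p2: "C * (\<alpha> / 2 * (\<alpha> / 4 + 2 / 3)) = of_real (a 1)"
    using a[of 1] by (simp add: field_simps)
  have "a 0 \<noteq> 0" using p1 False C(1) by auto
  then have "a 0 > 0" using nonneg[of 0] by simp
  have "of_real (a 0) * (\<alpha> / 4 + 2 / 3) = complex_of_real (a 1)"
    using p1 p2 by (metis mult.assoc)
  then have "\<alpha> = of_real (4 * (a 1 / a 0 - 2 / 3))"
    using \<open>a 0 \<noteq> 0\<close> by (simp add: field_simps)
  then obtain x where x: "\<alpha> = of_real x" by blast
  then obtain d where d: "C = of_real d" "d > 0"
    using C(2) by (auto elim!: Reals_cases)
  have ad: "norm (p_poly (Suc n) \<alpha>) = a n / d" for n
  proof -
    have "d * norm (p_poly (Suc n) \<alpha>) = a n"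
      using arg_cong[OF a[of n], of norm] d nonneg[of n] by (simp add: norm_mult del: p_poly.simps)
    then show ?thesis using d(2) by (simp add: field_simps)
  qed
  have "complex_of_real (d * (x / 2)) = of_real (a 0)" using p1 by (simp add: x d)
  then have "d * (x / 2) = a 0" by (simp only: of_real_eq_iff)
  then have "x > 0" using \<open>a 0 > 0\<close> d(2) by (metis half_gt_zero_iff zero_less_mult_pos)
  have "a 0 * (x / 4 + 2 / 3) = a 1"
  proof -
    have "complex_of_real (a 0 * (x / 4 + 2 / 3)) = of_real (a 1)"
      using \<open>of_real (a 0) * (\<alpha> / 4 + 2 / 3) = complex_of_real (a 1)\<close> by (simp add: x)
    then show ?thesis by (simp only: of_real_eq_iff)
  qed
  then have "a 1 > 0" using \<open>x > 0\<close> \<open>a 0 > 0\<close> by (metis add_pos_pos divide_pos_pos mult_pos_pos zero_less_numeral)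
  have pos: "a n > 0 \<and> a (Suc n) > 0" for n
  proof (induction n)
    case (Suc n)
    then have "(a (Suc n))\<^sup>2 \<le> a n * a (Suc (Suc n))"
      by (intro nonneg_quadratic_imp_log_convex quad) simp
    moreover have "0 < (a (Suc n))\<^sup>2" using Suc by simp
    ultimately have "0 < a n * a (Suc (Suc n))" by linarith
    then show ?case using Suc by (simp add: zero_less_mult_iff)
  qed (use \<open>a 0 > 0\<close> \<open>a 1 > 0\<close> in simp)
  have dec: "a (Suc n) \<le> a n" for n
  proof (rule log_convex_subexponential_imp_decreasing)
    show "a n > 0" for n using pos by simp
    show "(a (Suc n))\<^sup>2 \<le> a n * a (Suc (Suc n))" for n
      using pos[of n] by (intro nonneg_quadratic_imp_log_convex quad) simp
    fix w :: real assume w: "0 < w" "w < 1"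
    have "(\<lambda>n. norm (p_poly n \<alpha> * of_real w ^ n)) \<longlonglongrightarrow> 0"
      using w by (intro summable_LIMSEQ_zero summable_norm_p_poly) simp
    then have "(\<lambda>n. norm (p_poly (Suc n) \<alpha> * of_real w ^ Suc n)) \<longlonglongrightarrow> 0"
      by (rule LIMSEQ_Suc)
    then have "(\<lambda>n. d / w * norm (p_poly (Suc n) \<alpha> * of_real w ^ Suc n)) \<longlonglongrightarrow> 0"
      by (rule tendsto_mult_right_zero)
    moreover have "d / w * norm (p_poly (Suc n) \<alpha> * of_real w ^ Suc n) = a n * w ^ n" for n
      unfolding norm_mult norm_power norm_of_real ad using w d(2) by simp
    ultimately show "(\<lambda>n. a n * w ^ n) \<longlonglongrightarrow> 0" by (simp del: p_poly.simps)
  qed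
  have "a n \<le> a 0" for n
    using lift_Suc_antimono_le[of a 0 n] dec by simp
  then have "norm (p_poly (Suc n) \<alpha>) \<le> a 0 / d" for n
    unfolding ad using d(2) by (simp add: divide_right_mono)
  then have "norm (p_poly n (of_real x)) \<le> max 1 (a 0 / d)" for n
    unfolding x by (cases n) (auto simp: le_max_iff_disj simp del: p_poly.simps(2))
  from bounded_p_poly_imp_le_1[OF this] \<open>x > 0\<close> show ?thesis by (simp add: x)
qed simp

lemma stieltjes_p_poly_imp_unit_interval:
  assumes "represents_moments {0..} \<sigma> (\<lambda>n. p_poly (n + 1) \<alpha>)"
  shows "\<alpha> \<in> \<real> \<and> 0 \<le> Re \<alpha> \<and> Re \<alpha> \<le> 1"
proof -
  have sets: "sets \<sigma> = sets (restrict_space borel {0..})"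
    and int: "\<And>n. integrable \<sigma> (\<lambda>x. x ^ n)"
    and mom: "\<And>n. p_poly (Suc n) \<alpha> = complex_of_real (\<integral>x. x ^ n \<partial>\<sigma>)"
    using assms by (auto simp: represents_moments_def)
  have space: "space \<sigma> = {0..}" using sets_eq_imp_space_eq[OF sets] by (simp add: space_restrict_space)
  show ?thesis
  proof (rule log_convex_p_poly_imp_unit_interval[where C = 1 and a = "\<lambda>n. \<integral>x. x ^ n \<partial>\<sigma>"])
    show "0 \<le> (\<integral>x. x ^ n \<partial>\<sigma>)" for n
      by (rule integral_nonneg_AE) (use space in auto)
    fix n and l :: real
    have "(\<integral>x. x ^ Suc (Suc n) \<partial>\<sigma>) - 2 * l * (\<integral>x. x ^ Suc n \<partial>\<sigma>) + l\<^sup>2 * (\<integral>x. x ^ n \<partial>\<sigma>) =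
       (\<integral>x. x ^ Suc (Suc n) - 2 * l * x ^ Suc n + l\<^sup>2 * x ^ n \<partial>\<sigma>)"
      by (simp only: Bochner_Integration.integral_add Bochner_Integration.integral_diff
          Bochner_Integration.integrable_diff int integrable_mult_right integral_mult_right_zero)
    also have "\<dots> = (\<integral>x. x ^ n * (x - l)\<^sup>2 \<partial>\<sigma>)"
      by (intro Bochner_Integration.integral_cong refl) (simp add: power2_eq_square algebra_simps)
    also have "0 \<le> \<dots>" by (rule integral_nonneg_AE) (use space in auto)
    finally show "0 \<le> (\<integral>x. x ^ Suc (Suc n) \<partial>\<sigma>) - 2 * l * (\<integral>x. x ^ Suc n \<partial>\<sigma>) + l\<^sup>2 * (\<integral>x. x ^ n \<partial>\<sigma>)" .
  qed (use mom in \<open>simp_all del: p_poly.simps\<close>)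
qed

text \<open>
  Letting \<open>x\<close> tend to 0 from the right in the conditions on the derivatives yields reality and
  nonnegativity of the coefficients. Their log-convexity holds because every shifted function is again
  completely monotonic.
\<close>

lemma completely_monotonic_egf_imp_unit_interval:
  assumes cm: "completely_monotonic (\<lambda>x. egf (\<lambda>n. exp \<alpha> * p_poly (n + 1) \<alpha>) (of_real x))"
  shows "\<alpha> \<in> \<real> \<and> 0 \<le> Re \<alpha> \<and> Re \<alpha> \<le> 1"
proof -
  define A where "A = (\<lambda>n. exp \<alpha> * p_poly (n + 1) \<alpha>)"
  have A: "exp_bounded A" unfolding A_def by (rule exp_bounded_p_poly)
  have F: "\<And>n x. x > 0 \<Longrightarrow> egf (shift_seq n A) (of_real x) \<in> \<real>"
    "\<And>n x. x > 0 \<Longrightarrow> 0 \<le> Re (egf (shift_seq n A) (of_real x))"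
    using cm completely_monotonic_egf_iff[OF A] unfolding A_def by blast+
  have lim: "((\<lambda>x. egf (shift_seq n A) (of_real x)) \<longlongrightarrow> A n) (at_right 0)" for n
    using tendsto_egf_at_right_0[OF exp_bounded_shift[OF A, of n]] by (simp add: shift_seq_def)
  have real: "A n \<in> \<real>" for n
    by (rule Lim_in_closed_set[OF closed_complex_Reals _ _ lim[of n]])
       (auto simp: F(1) eventually_at_right_less intro: eventually_at_rightI[of 0 1])
  have nonneg: "0 \<le> Re (A n)" for n
    by (rule tendsto_lowerbound[OF tendsto_Re[OF lim[of n]]])
       (auto simp: F(2) intro: eventually_at_rightI[of 0 1])
  show ?thesis
  proof (rule log_convex_p_poly_imp_unit_interval[where C = "exp \<alpha>" and a = "\<lambda>n. Re (A n)"])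
    show "exp \<alpha> * p_poly (Suc n) \<alpha> = of_real (Re (A n))" for n
      using of_real_Re[OF real[of n]] by (simp add: A_def del: p_poly.simps)
    show "exp \<alpha> \<in> \<real> \<and> 0 < Re (exp \<alpha>)" if "\<alpha> \<in> \<real>"
    proof -
      obtain x where "\<alpha> = of_real x" using \<open>\<alpha> \<in> \<real>\<close> by (rule Reals_cases)
      then have "exp \<alpha> = of_real (exp x)" by (simp add: exp_of_real)
      then show ?thesis by simp
    qed
    fix n and l :: real
    have "0 \<le> Re (shift_seq n A 2) - 2 * l * Re (shift_seq n A 1) + l\<^sup>2 * Re (shift_seq n A 0)"
    proof (rule egf_nonneg_imp_log_convex[OF exp_bounded_shift[OF A]])
      fix m and x :: real assume "x > 0"
      have "shift_seq m (shift_seq n A) = shift_seq (n + m) A"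
        by (simp add: shift_seq_def fun_eq_iff add.assoc)
      then show "0 \<le> Re (egf (shift_seq m (shift_seq n A)) (of_real x))"
        using F(2)[OF \<open>x > 0\<close>] by simp
    qed
    then show "0 \<le> Re (A (Suc (Suc n))) - 2 * l * Re (A (Suc n)) + l\<^sup>2 * Re (A n)"
      by (simp add: shift_seq_def)
  qed (use nonneg in auto)
qed

section \<open>Consequences of a representing measure on the unit interval\<close>

text \<open>
  Interchanging sum and integral shows that the \<open>n\<close>-th derivative is, up to the sign \<open>(-1)\<^sup>n\<close>, the
  integral of \<open>C t\<^sup>n exp (- s t)\<close>.
\<close>

lemma egf_of_hausdorff_moments:
  assumes \<sigma>: "represents_moments {0..1} \<sigma> m" and "C \<ge> 0"
    and bd: "exp_bounded (\<lambda>n. of_real C * m n)"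
  shows "completely_monotonic (\<lambda>x. egf (\<lambda>n. of_real C * m n) (of_real x))"
  unfolding completely_monotonic_egf_iff[OF bd]
proof (intro allI impI)
  fix n and s :: real assume s: "s > 0"
  have sets: "sets \<sigma> = sets (restrict_space borel {0..1})"
    and int: "\<And>n. integrable \<sigma> (\<lambda>x. x ^ n)"
    and mom: "\<And>n. m n = complex_of_real (\<integral>x. x ^ n \<partial>\<sigma>)"
    using \<sigma> by (auto simp: represents_moments_def)
  have space: "space \<sigma> = {0..1}" using sets_eq_imp_space_eq[OF sets] by (simp add: space_restrict_space)
  define f where "f = (\<lambda>k t. C * ((- s) ^ k / fact k) * t ^ (n + k) :: real)"
  have f: "f k t = C * t ^ n * ((- s * t) ^ k /\<^sub>R fact k)" for k t
    by (simp add: f_def power_add power_mult_distrib power_minus[of "s * t"] power_minus[of s] field_simps)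
  have "(\<lambda>k. integral\<^sup>L \<sigma> (f k)) sums (\<integral>t. (\<Sum>k. f k t) \<partial>\<sigma>)"
  proof (rule sums_integral)
    show "integrable \<sigma> (f k)" for k
      unfolding f_def by (intro integrable_mult_right int)
    show "AE t in \<sigma>. summable (\<lambda>k. norm (f k t))"
      unfolding f norm_mult by (intro AE_I2 summable_mult summable_norm_exp)
    have "summable (\<lambda>k. norm ((- 1) ^ k * shift_seq n (\<lambda>n. of_real C * m n) k / fact k * of_real s ^ k))"
      by (rule summable_egf[OF exp_bounded_shift[OF bd]])
    moreover have "norm ((- 1) ^ k * shift_seq n (\<lambda>n. of_real C * m n) k / fact k * of_real s ^ k) =
        (\<integral>t. norm (f k t) \<partial>\<sigma>)" for k
    proof -
      have "(\<integral>t. norm (f k t) \<partial>\<sigma>) = (\<integral>t. C * (s ^ k / fact k) * t ^ (n + k) \<partial>\<sigma>)"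
        using s \<open>C \<ge> 0\<close> space
        by (intro Bochner_Integration.integral_cong refl) (auto simp: f_def abs_mult power_abs)
      also have "\<dots> = C * (s ^ k / fact k) * (\<integral>t. t ^ (n + k) \<partial>\<sigma>)" by simp
      also have "(\<integral>t. t ^ (n + k) \<partial>\<sigma>) = \<bar>\<integral>t. t ^ (n + k) \<partial>\<sigma>\<bar>"
        using space by (intro abs_of_nonneg[symmetric] integral_nonneg_AE) auto
      finally show ?thesis
        using s \<open>C \<ge> 0\<close> by (simp add: shift_seq_def mom norm_mult norm_divide norm_power)
    qed
    ultimately show "summable (\<lambda>k. \<integral>t. norm (f k t) \<partial>\<sigma>)" by simp
  qed
  then have "(\<lambda>k. complex_of_real (integral\<^sup>L \<sigma> (f k))) sums of_real (\<integral>t. (\<Sum>k. f k t) \<partial>\<sigma>)"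
    by (rule sums_of_real)
  moreover have "complex_of_real (integral\<^sup>L \<sigma> (f k)) =
      (- 1) ^ k * shift_seq n (\<lambda>n. of_real C * m n) k / fact k * of_real s ^ k" for k
    by (simp add: f_def shift_seq_def mom power_minus[of "complex_of_real s"] del: Bochner_Integration.integral_mult_right)
  ultimately have eq: "egf (shift_seq n (\<lambda>n. of_real C * m n)) (of_real s) = of_real (\<integral>t. (\<Sum>k. f k t) \<partial>\<sigma>)"
    unfolding egf_def by (simp add: sums_iff)
  have "(\<Sum>k. f k t) = C * t ^ n * exp (- s * t)" for t
    unfolding f exp_def by (rule suminf_mult) (rule summable_exp_generic)
  then have "0 \<le> (\<integral>t. (\<Sum>k. f k t) \<partial>\<sigma>)"
    using space \<open>C \<ge> 0\<close> by (intro integral_nonneg_AE) auto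
  then show "egf (shift_seq n (\<lambda>n. of_real C * m n)) (of_real s) \<in> \<real> \<and>
      0 \<le> Re (egf (shift_seq n (\<lambda>n. of_real C * m n)) (of_real s))"
    unfolding eq by simp
qed

lemma hausdorff_imp_bounded:
  assumes "hausdorff_moment_seq m"
  shows "\<exists>K. \<forall>n. norm (m n) \<le> K"
proof -
  obtain \<sigma> where sets: "sets \<sigma> = sets (restrict_space borel {0..1})"
    and int: "\<And>n. integrable \<sigma> (\<lambda>x. x ^ n)"
    and mom: "\<And>n. m n = complex_of_real (\<integral>x. x ^ n \<partial>\<sigma>)"
    using assms by (auto simp: hausdorff_moment_seq_def represents_moments_def)
  have space: "space \<sigma> = {0..1}" using sets_eq_imp_space_eq[OF sets] by (simp add: space_restrict_space)
  have "norm (m n) \<le> (\<integral>x. x ^ 0 \<partial>\<sigma>)" for n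
  proof -
    have "0 \<le> (\<integral>x. x ^ n \<partial>\<sigma>)" by (rule integral_nonneg_AE) (use space in auto)
    moreover have "(\<integral>x. x ^ n \<partial>\<sigma>) \<le> (\<integral>x. x ^ 0 \<partial>\<sigma>)"
      by (rule integral_mono[OF int int]) (use space in \<open>auto simp: power_le_one\<close>)
    ultimately show ?thesis by (simp add: mom)
  qed
  then show ?thesis by blast
qed

lemma hausdorff_imp_stieltjes:
  assumes "hausdorff_moment_seq m"
  shows "stieltjes_moment_seq m"
proof -
  obtain \<sigma> where sets: "sets \<sigma> = sets (restrict_space borel {0..1})"
    and int: "\<And>n. integrable \<sigma> (\<lambda>x. x ^ n)"
    and mom: "\<And>n. m n = complex_of_real (\<integral>x. x ^ n \<partial>\<sigma>)"
    using assms by (auto simp: hausdorff_moment_seq_def represents_moments_def)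
  have space: "space \<sigma> = {0..1}" using sets_eq_imp_space_eq[OF sets] by (simp add: space_restrict_space)
  have "(\<lambda>x::real. x) \<in> measurable (restrict_space borel {0..1}) borel"
    by (rule measurable_restrict_space1) simp
  then have "(\<lambda>x. x) \<in> measurable \<sigma> borel" by (simp cong: measurable_cong_sets add: sets)
  then have id: "(\<lambda>x. x) \<in> measurable \<sigma> (restrict_space borel {0..})"
    by (rule measurable_restrict_space2[rotated]) (use space in auto)
  have pow: "(\<lambda>x::real. x ^ n) \<in> borel_measurable (restrict_space borel {0..})" for n
    by (rule measurable_restrict_space1) simp
  have "represents_moments {0..} (distr \<sigma> (restrict_space borel {0..}) (\<lambda>x. x)) m"
    unfolding represents_moments_def
    using integrable_distr_eq[OF id pow] integral_distr[OF id pow] int mom by simp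
  then show ?thesis unfolding stieltjes_moment_seq_def by blast
qed

text \<open>
  Markov's inequality for \<open>x\<^sup>n\<close> bounds the mass of \<open>[q, \<infinity>)\<close> by \<open>K / q\<^sup>n\<close>, for every \<open>n\<close>. The half line
  beyond 1 is exhausted by countably many such sets with \<open>q > 1\<close>.
\<close>

lemma bounded_moments_imp_support:
  assumes \<sigma>: "represents_moments {0..} \<sigma> m" and K: "\<And>n. norm (m n) \<le> K"
  shows "emeasure \<sigma> (space \<sigma> - {0..1}) = 0"
proof -
  have sets: "sets \<sigma> = sets (restrict_space borel {0..})"
    and int: "\<And>n. integrable \<sigma> (\<lambda>x. x ^ n)"
    and mom: "\<And>n. m n = complex_of_real (\<integral>x. x ^ n \<partial>\<sigma>)"
    using \<sigma> by (auto simp: represents_moments_def)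
  have space: "space \<sigma> = {0..}" using sets_eq_imp_space_eq[OF sets] by (simp add: space_restrict_space)
  have "integrable \<sigma> (\<lambda>x. 1 :: real)" using int[of 0] by simp
  then interpret finite_measure \<sigma>
    by (intro finite_measureI) (simp add: integrable_iff_bounded less_top)
  have [measurable]: "(\<lambda>x. x) \<in> borel_measurable \<sigma>" using borel_measurable_integrable[OF int[of 1]] by simp
  define S where "S = (\<lambda>j. {x \<in> space \<sigma>. 1 + 1 / real (Suc j) \<le> x})"
  have S: "S j \<in> sets \<sigma>" for j unfolding S_def by measurable
  have "measure \<sigma> (S j) = 0" for j
  proof -
    define q where "q = 1 + 1 / real (Suc j)"
    have q: "q > 1" by (simp add: q_def)
    have Sq: "S j = {x \<in> space \<sigma>. q \<le> x}" by (simp add: S_def q_def)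
    have "measure \<sigma> (S j) \<le> K * (1 / q) ^ n" for n
    proof -
      have AE: "AE x in \<sigma>. 0 \<le> x ^ n" by (rule AE_I2) (use space in auto)
      have "measure \<sigma> (S j) \<le> measure \<sigma> {x \<in> space \<sigma>. q ^ n \<le> x ^ n}"
        using q by (intro finite_measure_mono) (auto simp: Sq intro!: power_mono)
      also have "\<dots> \<le> (\<integral>x. x ^ n \<partial>\<sigma>) / q ^ n"
        using integral_Markov_inequality_measure[OF int[of n], of "{}" "q ^ n"] AE q by auto
      also have "\<dots> \<le> K / q ^ n"
        using K[of n] q by (intro divide_right_mono) (auto simp: mom)
      finally show ?thesis by (simp add: power_divide)
    qed
    moreover have "(\<lambda>n. K * (1 / q) ^ n) \<longlonglongrightarrow> 0"
      using q by (intro tendsto_mult_right_zero LIMSEQ_power_zero) simp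
    ultimately have "measure \<sigma> (S j) \<le> 0" by (intro LIMSEQ_le_const) auto
    then show ?thesis using measure_nonneg[of \<sigma> "S j"] by linarith
  qed
  then have "emeasure \<sigma> (\<Union>j. S j) = 0"
    using S by (intro emeasure_UN_eq_0) (auto simp: emeasure_eq_measure)
  moreover have "space \<sigma> - {0..1} = (\<Union>j. S j)"
  proof (intro equalityI subsetI)
    fix x assume "x \<in> space \<sigma> - {0..1}"
    then have x: "x \<in> space \<sigma>" "x > 1" using space by auto
    then obtain j where "inverse (real (Suc j)) < x - 1" using reals_Archimedean[of "x - 1"] by auto
    then show "x \<in> (\<Union>j. S j)" using x by (auto simp: S_def inverse_eq_divide intro!: exI[of _ j])
  next
    fix x assume "x \<in> (\<Union>j. S j)"
    then obtain j where "x \<in> space \<sigma>" "1 + 1 / real (Suc j) \<le> x" by (auto simp: S_def)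
    moreover have "1 / real (Suc j) > 0" by simp
    ultimately have "x \<in> space \<sigma>" "x > 1" by linarith+
    then show "x \<in> space \<sigma> - {0..1}" by simp
  qed
  ultimately show ?thesis by simp
qed

section \<open>The three equivalent conditions\<close>

theorem theorem1p5:
  fixes \<alpha> :: complex and r c :: real
  assumes "r > 0" and "c > 1"
  shows "(stieltjes_moment_seq (\<lambda>n. p_poly (n + 1) \<alpha>) \<longleftrightarrow>
            completely_monotonic (\<lambda>x. phi r c \<alpha> (complex_of_real x))) \<and>
         (completely_monotonic (\<lambda>x. phi r c \<alpha> (complex_of_real x)) \<longleftrightarrow>
            \<alpha> \<in> \<real> \<and> 0 \<le> Re \<alpha> \<and> Re \<alpha> \<le> 1) \<and>
         (stieltjes_moment_seq (\<lambda>n. p_poly (n + 1) \<alpha>) \<longrightarrow>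
            (\<forall>\<sigma>. represents_moments {0..} \<sigma> (\<lambda>n. p_poly (n + 1) \<alpha>) \<longrightarrow>
                  emeasure \<sigma> (space \<sigma> - {0..1}) = 0) \<and>
            hausdorff_moment_seq (\<lambda>n. p_poly (n + 1) \<alpha>))"
proof -
  define iii where "iii \<longleftrightarrow> \<alpha> \<in> \<real> \<and> 0 \<le> Re \<alpha> \<and> Re \<alpha> \<le> 1"
  have phi: "(\<lambda>x. phi r c \<alpha> (of_real x)) = (\<lambda>x. egf (\<lambda>n. exp \<alpha> * p_poly (n + 1) \<alpha>) (of_real x))"
    using phi_eq_egf[OF assms] by blast
  have i: "iii" if "stieltjes_moment_seq (\<lambda>n. p_poly (n + 1) \<alpha>)"
    using that stieltjes_p_poly_imp_unit_interval unfolding iii_def stieltjes_moment_seq_def by blast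
  have ii: "iii" if "completely_monotonic (\<lambda>x. phi r c \<alpha> (of_real x))"
    using completely_monotonic_egf_imp_unit_interval that unfolding phi iii_def by blast
  have hausdorff: "hausdorff_moment_seq (\<lambda>n. p_poly (n + 1) \<alpha>)" if iii
  proof -
    have "\<alpha> = of_real (Re \<alpha>)" using that unfolding iii_def by (simp add: of_real_Re)
    then show ?thesis using hausdorff_p_poly[of "Re \<alpha>"] that unfolding iii_def by metis
  qed
  have cm: "completely_monotonic (\<lambda>x. phi r c \<alpha> (of_real x))" if iii: iii
  proof -
    have \<alpha>: "exp \<alpha> = of_real (exp (Re \<alpha>))"
      using iii unfolding iii_def by (metis exp_of_real of_real_Re)
    obtain \<sigma> where "represents_moments {0..1} \<sigma> (\<lambda>n. p_poly (n + 1) \<alpha>)"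
      using hausdorff[OF iii] by (auto simp: hausdorff_moment_seq_def)
    then show ?thesis
      unfolding phi \<alpha> by (rule egf_of_hausdorff_moments[OF _ _ exp_bounded_p_poly]) simp
  qed
  have support: "emeasure \<sigma> (space \<sigma> - {0..1}) = 0"
    if "represents_moments {0..} \<sigma> (\<lambda>n. p_poly (n + 1) \<alpha>)" iii for \<sigma>
    using hausdorff_imp_bounded[OF hausdorff[OF that(2)]] bounded_moments_imp_support[OF that(1)] by blast
  show ?thesis
    using i ii hausdorff hausdorff_imp_stieltjes cm support unfolding iii_def[symmetric] by blast
qed

end
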